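(* Let $r,m,\ell\ge1$, let $\mathfrak q_1,\dots,\mathfrak q_\ell\in A=\mathbb F_q[T]$ be distinct monic irreducible polynomials of degree $m$, none equal to $T$, and let $\phi$ be the Drinfeld module over $k=\mathbb F_{q^r}$ (with $T\mapsto 0$) given by $\phi_T=\tau^r$. Put $R=\mathbb F_{q^r}\{\tau\}$, $Q_i=\mathfrak q_i(\tau^r)$, $\Pi=\prod_iQ_i$, $\mathsf N=\deg_\tau(\Pi)=m\ell r$, $\mathcal R_\Gamma=\prod_{i=1}^\ell R/(Q_i)$, and let $\Theta:\mathcal R_\Gamma\to\operatorname{Mat}_{r\times r}(\mathbb F_{q^m})^\ell$ be the blockwise isomorphism sending each residue class modulo $Q_i$ to the matrix of its action on $\phi[\mathfrak q_i]$. For every $\boldsymbol y\in\mathcal R_\Gamma$, $$\operatorname{wt}_{\mathrm{ps}}(\boldsymbol y)=m\,\operatorname{wt}_{SR}(\Theta(\boldsymbol y)).$$ Thus $\Theta$ is an isometry after rescaling the poly-skew metric by $1/m$.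
   Context: $q$ is a prime power. $R=\mathbb F_{q^r}\{\tau\}$ is the skew polynomial ring with $\tau\alpha=\alpha^q\tau$ for $\alpha\in\mathbb F_{q^r}$; it is Euclidean on both sides. An element $\sum a_i\tau^i$ acts on an algebraic closure $\overline k$ by $x\mapsto\sum a_ix^{q^i}$, and multiplication corresponds to composition. The elements $Q_i$ and $\Pi$ are central in $R$, so $(Q_i)=RQ_i$ and $(\Pi)=R\Pi$ are two-sided ideals. $\operatorname{gcrd}$ denotes the monic greatest common right divisor (with $\operatorname{gcrd}(\Pi,0)=\Pi$). The map $\operatorname{CRT}_\Gamma:R/(\Pi)\to\mathcal R_\Gamma$ taking $u$ to its right remainders modulo the $Q_i$ is an isomorphism. For $\boldsymbol y\in\mathcal R_\Gamma$ let $Y\in R$ be its CRT lift, i.e. the unique element with $\deg_\tau(Y)<\mathsf N$ and $\operatorname{CRT}_\Gamma(Y)=\boldsymbol y$. The poly-skew weight is $\operatorname{wt}_{\mathrm{ps}}(\boldsymbol y)=\mathsf N-\deg_\tau\operatorname{gcrd}(\Pi,Y)$, and the poly-skew distance of $\boldsymbol y,\boldsymbol y'$ is $\operatorname{wt}_{\mathrm{ps}}(\boldsymbol y-\boldsymbol y')$. The Drinfeld module is $\phi:A\to k\{\tau\}$, $a\mapsto\phi_a=a(\tau^r)$; its endomorphism ring is $R$. $\phi[a]=\{\alpha\in\overline k:\phi_a(\alpha)=0\}$ is an $A$-module via $b\cdot\alpha=\phi_b(\alpha)$, and $\phi[\mathfrak q_i]\cong(A/\mathfrak q_i)^r\cong\mathbb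 F_{q^m}^r$. Restriction of $u\in R$ to $\phi[\mathfrak q_i]$ induces an isomorphism $\Theta_i:R/(Q_i)\to\operatorname{End}_{A/(\mathfrak q_i)}(\phi[\mathfrak q_i])\cong\operatorname{Mat}_{r\times r}(\mathbb F_{q^m})$ (after fixing isomorphisms $A/\mathfrak q_i\cong\mathbb F_{q^m}$ and bases), and $\Theta((y_i)_i)=(\Theta_i(y_i))_i$. For a tuple $X=(X_1,\dots,X_\ell)$ of matrices, $\operatorname{wt}_{SR}(X)=\sum_i\operatorname{rk}_{\mathbb F_{q^m}}(X_i)$, and the sum-rank distance is $\operatorname{wt}_{SR}(X-X')$. *)

theory Defs
  imports
    "HOL-Algebra.Algebraic_Closure_Type"
    "Jordan_Normal_Form.DL_Rank"
    "HOL-Computational_Algebra.Computational_Algebra"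
    "HOL-Library.Cardinality"
begin

section \<open>The skew polynomial ring\<close>

text \<open>
  A skew polynomial $\sum_i a_i \tau^i$ is represented by the type \<^typ>\<open>'k poly\<close>, used only for
  its coefficient sequence and its addition; thus \<^const>\<open>Polynomial.degree\<close> is $\deg_\tau$ (except that
  the zero polynomial has degree 0).  The product is the one determined by
  $\tau \alpha = \alpha^q \tau$.
\<close>

definition skew_mult :: "nat \<Rightarrow> 'k::field poly \<Rightarrow> 'k poly \<Rightarrow> 'k poly" where
  "skew_mult q f g =
     (\<Sum>i\<le>Polynomial.degree f. \<Sum>j\<le>Polynomial.degree g.
        Polynomial.monom (Polynomial.coeff f i * Polynomial.coeff g j ^ (q ^ i)) (i + j))"

definition skew_ring :: "nat \<Rightarrow> 'k::field poly ring" where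
  "skew_ring q =
     \<lparr>carrier = UNIV, monoid.mult = skew_mult q, one = 1, ring.zero = 0, add = (+)\<rparr>"

lemma skew_mult_tau_const:
  "skew_mult q (Polynomial.monom 1 1) [:a:] = skew_mult q [:a ^ q:] (Polynomial.monom 1 1)"
  by (simp add: skew_mult_def Polynomial.degree_monom_eq)

definition skew_act :: "nat \<Rightarrow> 'k::field poly \<Rightarrow> 'k alg_closure \<Rightarrow> 'k alg_closure" where
  "skew_act q f x = (\<Sum>i\<le>Polynomial.degree f. to_ac (Polynomial.coeff f i) * x ^ (q ^ i))"

definition right_dvd :: "nat \<Rightarrow> 'k::field poly \<Rightarrow> 'k poly \<Rightarrow> bool" where
  "right_dvd q d f \<longleftrightarrow> (\<exists>h. f = skew_mult q h d)"

definition gcrd :: "nat \<Rightarrow> 'k::field poly \<Rightarrow> 'k poly \<Rightarrow> 'k poly" where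
  "gcrd q f g =
     (THE d. lead_coeff d = 1 \<and> right_dvd q d f \<and> right_dvd q d g \<and>
             (\<forall>c. right_dvd q c f \<and> right_dvd q c g \<longrightarrow> right_dvd q c d))"


section \<open>The Drinfeld module and its torsion\<close>

text \<open>
  $\phi_a = a(\tau^r)$, where \<open>\<iota>\<close> is the inclusion of $\mathbb F_q$ into $\mathbb F_{q^r}$.
\<close>

definition drinfeld :: "('f::field \<Rightarrow> 'k::field) \<Rightarrow> nat \<Rightarrow> 'f poly \<Rightarrow> 'k poly" where
  "drinfeld \<iota> r a =
     (\<Sum>i\<le>Polynomial.degree a. Polynomial.monom (\<iota> (Polynomial.coeff a i)) (r * i))"

lemma drinfeld_T: "field_hom \<iota> \<Longrightarrow> drinfeld \<iota> r [:0, 1:] = Polynomial.monom 1 r"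
proof -
  assume "field_hom \<iota>"
  then interpret field_hom \<iota> .
  show ?thesis by (simp add: drinfeld_def)
qed

definition torsion ::
  "nat \<Rightarrow> ('f::field \<Rightarrow> 'k::field) \<Rightarrow> nat \<Rightarrow> 'f poly \<Rightarrow> 'k alg_closure set" where
  "torsion q \<iota> r a = {\<alpha>. skew_act q (drinfeld \<iota> r a) \<alpha> = 0}"

text \<open>
  For an isomorphism \<open>\<psi>\<close> from $A/(\mathfrak q)$ to the field \<open>'e\<close>, the scalar \<open>c :: 'e\<close> acts on
  $\phi[\mathfrak q]$ as $\phi_b$ for any \<open>b\<close> whose residue class corresponds to \<open>c\<close>; the choice of
  \<open>b\<close> does not matter on $\phi[\mathfrak q]$.
\<close>

definition torsion_smult ::
  "nat \<Rightarrow> ('f::field \<Rightarrow> 'k::field) \<Rightarrow> nat \<Rightarrow> 'f poly \<Rightarrow> ('f poly set \<Rightarrow> 'e::field)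
     \<Rightarrow> 'e \<Rightarrow> 'k alg_closure \<Rightarrow> 'k alg_closure" where
  "torsion_smult q \<iota> r \<qq> \<psi> c \<alpha> =
     skew_act q (drinfeld \<iota> r (SOME b. \<psi> (PIdl\<^bsub>class_ring\<^esub> \<qq> +>\<^bsub>class_ring\<^esub> b) = c)) \<alpha>"

text \<open>
  The fields \<open>mult\<close> and \<open>one\<close> of the record type are irrelevant for a module.
\<close>

definition torsion_space ::
  "nat \<Rightarrow> ('f::field \<Rightarrow> 'k::field) \<Rightarrow> nat \<Rightarrow> 'f poly \<Rightarrow> ('f poly set \<Rightarrow> 'e::field)
     \<Rightarrow> ('e, 'k alg_closure) module" where
  "torsion_space q \<iota> r \<qq> \<psi> =
     \<lparr>carrier = torsion q \<iota> r \<qq>, monoid.mult = undefined, one = undefined,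
      ring.zero = 0, add = (+), module.smult = torsion_smult q \<iota> r \<qq> \<psi>\<rparr>"

text \<open>
  The matrix, with respect to the ordered basis \<open>b 0, \<dots>, b (r - 1)\<close> of $\phi[\mathfrak q]$, of the
  endomorphism induced by a residue class \<open>U\<close> modulo $R\,\mathfrak q(\tau^r)$; column \<open>j\<close>
  holds the coordinates of the image of \<open>b j\<close>.
\<close>

definition torsion_matrix ::
  "nat \<Rightarrow> ('f::field \<Rightarrow> 'k::field) \<Rightarrow> nat \<Rightarrow> 'f poly \<Rightarrow> ('f poly set \<Rightarrow> 'e::field)
     \<Rightarrow> (nat \<Rightarrow> 'k alg_closure) \<Rightarrow> 'k poly set \<Rightarrow> 'e mat" where
  "torsion_matrix q \<iota> r \<qq> \<psi> b U =
     (THE M. M \<in> carrier_mat r r \<and>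
        (\<forall>u\<in>U. \<forall>j<r. skew_act q u (b j) = (\<Sum>k<r. torsion_smult q \<iota> r \<qq> \<psi> (M $$ (k, j)) (b k))))"


section \<open>The product ring and the poly-skew weight\<close>

text \<open>
  \<open>Q\<close> stands for the family $Q_0,\dots,Q_{\ell-1}$.  The \<open>Q i\<close> of interest are central, so that
  \<open>PIdl Q i\<close> $= R Q_i$ is a two-sided ideal and the order of the factors of $\Pi$ is irrelevant.
\<close>

definition skew_Prod :: "nat \<Rightarrow> nat \<Rightarrow> (nat \<Rightarrow> 'k::field poly) \<Rightarrow> 'k poly" where
  "skew_Prod q l Q = foldr (\<lambda>i P. skew_mult q (Q i) P) [0..<l] 1"

definition res_ring :: "nat \<Rightarrow> (nat \<Rightarrow> 'k::field poly) \<Rightarrow> nat \<Rightarrow> 'k poly set ring" where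
  "res_ring q Q i = skew_ring q Quot (PIdl\<^bsub>skew_ring q\<^esub> (Q i))"

definition R_Gamma :: "nat \<Rightarrow> nat \<Rightarrow> (nat \<Rightarrow> 'k::field poly) \<Rightarrow> (nat \<Rightarrow> 'k poly set) set" where
  "R_Gamma q l Q = (\<Pi>\<^sub>E i\<in>{..<l}. carrier (res_ring q Q i))"

definition R_Gamma_diff ::
  "nat \<Rightarrow> nat \<Rightarrow> (nat \<Rightarrow> 'k::field poly)
     \<Rightarrow> (nat \<Rightarrow> 'k poly set) \<Rightarrow> (nat \<Rightarrow> 'k poly set) \<Rightarrow> nat \<Rightarrow> 'k poly set" where
  "R_Gamma_diff q l Q y y' = (\<lambda>i\<in>{..<l}. y i \<ominus>\<^bsub>res_ring q Q i\<^esub> y' i)"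

definition CRT :: "nat \<Rightarrow> nat \<Rightarrow> (nat \<Rightarrow> 'k::field poly) \<Rightarrow> 'k poly \<Rightarrow> nat \<Rightarrow> 'k poly set" where
  "CRT q l Q u = (\<lambda>i\<in>{..<l}. PIdl\<^bsub>skew_ring q\<^esub> (Q i) +>\<^bsub>skew_ring q\<^esub> u)"

definition CRT_lift ::
  "nat \<Rightarrow> nat \<Rightarrow> (nat \<Rightarrow> 'k::field poly) \<Rightarrow> (nat \<Rightarrow> 'k poly set) \<Rightarrow> 'k poly" where
  "CRT_lift q l Q y =
     (THE Y. Polynomial.degree Y < Polynomial.degree (skew_Prod q l Q) \<and> CRT q l Q Y = y)"

text \<open>
  The subtraction does not truncate, since the gcrd right-divides $\Pi \neq 0$.
\<close>

definition wt_ps :: "nat \<Rightarrow> nat \<Rightarrow> (nat \<Rightarrow> 'k::field poly) \<Rightarrow> (nat \<Rightarrow> 'k poly set) \<Rightarrow> nat" where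
  "wt_ps q l Q y =
     Polynomial.degree (skew_Prod q l Q)
       - Polynomial.degree (gcrd q (skew_Prod q l Q) (CRT_lift q l Q y))"

definition dist_ps ::
  "nat \<Rightarrow> nat \<Rightarrow> (nat \<Rightarrow> 'k::field poly)
     \<Rightarrow> (nat \<Rightarrow> 'k poly set) \<Rightarrow> (nat \<Rightarrow> 'k poly set) \<Rightarrow> nat" where
  "dist_ps q l Q y y' = wt_ps q l Q (R_Gamma_diff q l Q y y')"


section \<open>The sum-rank metric\<close>

definition mat_tuples :: "nat \<Rightarrow> nat \<Rightarrow> (nat \<Rightarrow> 'e::field mat) set" where
  "mat_tuples r l = (\<Pi>\<^sub>E i\<in>{..<l}. carrier_mat r r)"

definition wt_SR :: "nat \<Rightarrow> nat \<Rightarrow> (nat \<Rightarrow> 'e::field mat) \<Rightarrow> nat" where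
  "wt_SR r l M = (\<Sum>i<l. vec_space.rank r (M i))"

definition dist_SR ::
  "nat \<Rightarrow> nat \<Rightarrow> (nat \<Rightarrow> 'e::field mat) \<Rightarrow> (nat \<Rightarrow> 'e mat) \<Rightarrow> nat" where
  "dist_SR r l M N = wt_SR r l (\<lambda>i\<in>{..<l}. M i - N i)"

definition Theta ::
  "nat \<Rightarrow> ('f::field \<Rightarrow> 'k::field) \<Rightarrow> nat \<Rightarrow> nat \<Rightarrow> (nat \<Rightarrow> 'f poly)
     \<Rightarrow> (nat \<Rightarrow> 'f poly set \<Rightarrow> 'e::field) \<Rightarrow> (nat \<Rightarrow> nat \<Rightarrow> 'k alg_closure)
     \<Rightarrow> (nat \<Rightarrow> 'k poly set) \<Rightarrow> nat \<Rightarrow> 'e mat" where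
  "Theta q \<iota> r l \<qq> \<psi> b y = (\<lambda>i\<in>{..<l}. torsion_matrix q \<iota> r (\<qq> i) (\<psi> i) (b i) (y i))"

definition isometry_betw ::
  "'a set \<Rightarrow> ('a \<Rightarrow> 'a \<Rightarrow> real) \<Rightarrow> 'b set \<Rightarrow> ('b \<Rightarrow> 'b \<Rightarrow> real) \<Rightarrow> ('a \<Rightarrow> 'b) \<Rightarrow> bool" where
  "isometry_betw M d N d' f \<longleftrightarrow>
     bij_betw f M N \<and> (\<forall>x\<in>M. \<forall>y\<in>M. d' (f x) (f y) = d x y)"

end

theory Submission
  imports Defs
begin

text \<open>
  Skew polynomials act faithfully on $\overline k$, and a nonzero $u \in R$ has at most
  $q^{\deg_\tau u}$ zeros.  The given basis shows $|\phi[\mathfrak q_i]| = q^{mr}$, so $\Pi$ attains this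
  bound, and hence so does every right divisor of $\Pi$.  By the Bezout identity the zeros of
  $\operatorname{gcrd}(\Pi, Y)$ are those of $\Pi$ killed by $Y$, so $q^{\deg_\tau \operatorname{gcrd}(\Pi, Y)}$
  counts $\ker(Y | \phi[\prod_i \mathfrak q_i])$.  As $Y$ commutes with the $A$-action, that kernel is the
  direct sum of the kernels on the $\phi[\mathfrak q_i]$, and the $i$-th of these has
  $q^{m(r - \operatorname{rk} X_i)}$ elements by rank-nullity.  Bijectivity of $\operatorname{CRT}_\Gamma$ and of $\Theta$
  follows by comparing cardinalities, since a skew polynomial with too many zeros is $0$.
\<close>

section \<open>Counting over finite fields\<close>

text \<open>The degree in \<tau> measures kernels over F_q, the rank measures them over F_{q^m}. No
  dimensions are compared directly: both numbers are read off as exponents in the cardinality of one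
  finite kernel, and the factor m is the exponent in \<open>CARD('e) = q ^ m\<close>. Counting also
  stands in for separability: that \<Pi> has as many zeros as its degree permits comes from the size
  of the torsion, not from a derivative. The splitting of kernels rests on Bezout relations in A,
  which are made by inverting residues in the field \<open>'e\<close>.\<close>

lemma finite_field_pow_card:
  fixes x :: "'a::{field,finite}"
  shows "x ^ CARD('a) = x"
proof (cases "x = 0")
  case True
  then show ?thesis by (simp add: zero_power)
next
  case False
  have "bij_betw ((*) x) (UNIV - {0}) (UNIV - {0})"
    by (rule bij_betwI[of _ _ _ "\<lambda>y. y / x"]) (use False in auto)
  \<comment> \<open>Multiplication by \<open>x\<close> permutes the nonzero elements; cancelling
    their nonzero product leaves \<open>x ^ (CARD('a) - 1) = 1\<close>.\<close>
  then have "(\<Prod>y\<in>UNIV - {0}. x * y) = \<Prod>(UNIV - {0})"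
    by (rule prod.reindex_bij_betw)
  then have "x ^ (CARD('a) - 1) = 1"
    by (simp add: prod.distrib)
  moreover have "CARD('a) > 0" by simp
  ultimately show ?thesis by (metis mult.right_neutral power_minus_mult mult_1)
qed

lemma finite_field_pow_card_pow:
  fixes x :: "'a::{field,finite}"
  shows "x ^ (CARD('a) ^ n) = x"
  by (induction n) (simp_all add: power_mult finite_field_pow_card)

text \<open>$(1 + X)^q - X^q - 1$ has degree less than $q$ and vanishes on all of $\mathbb F_q$.\<close>

lemma finite_field_card_choose_eq_0:
  assumes "0 < i" "i < CARD('a)"
  shows "of_nat (CARD('a) choose i) = (0::'a::{field,finite})"
proof -
  let ?q = "CARD('a)"
  define P :: "'a poly" where "P = [:1, 1:] ^ ?q - Polynomial.monom 1 ?q - 1"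
  have coeff: "Polynomial.coeff P j =
      of_nat (?q choose j) - (if j = ?q then 1 else 0) - (if j = 0 then 1 else 0)" for j
  proof (cases "j \<le> ?q")
    case True
    then show ?thesis
      by (simp add: P_def coeff_linear_poly_power)
  next
    case False
    moreover have "Polynomial.degree ([:1, 1 :: 'a:] ^ ?q) \<le> ?q"
      using degree_power_le[of "[:1, 1 :: 'a:]" ?q] by simp
    ultimately show ?thesis
      by (simp add: P_def coeff_eq_0 binomial_eq_0)
  qed
  have "P = 0"
  proof (rule ccontr)
    assume "P \<noteq> 0"
    have "poly P x = 0" for x
      by (simp add: P_def poly_monom finite_field_pow_card)
    then have "{x. poly P x = 0} = UNIV" by auto
    with card_poly_roots_bound[OF \<open>P \<noteq> 0\<close>] have "?q \<le> Polynomial.degree P" by simp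
    \<comment> \<open>At exponent \<open>?q\<close> the binomial coefficient 1 is cancelled by the
      subtracted monomial; beyond it everything vanishes.\<close>
    moreover have "Polynomial.degree P < ?q"
      by (rule degree_lessI) (use \<open>P \<noteq> 0\<close> in \<open>auto simp: coeff binomial_eq_0\<close>)
    ultimately show False by simp
  qed
  then show ?thesis using coeff[of i] assms by simp
qed

text \<open>Each fibre over a point of the image is a translate of the kernel. Additivity is asked
  on \<open>A\<close> alone, since the groups to be counted are finite kernels inside an infinite
  field.\<close>

lemma card_eq_card_image_times_card_kernel:
  fixes f :: "'a::ab_group_add \<Rightarrow> 'b::ab_group_add"
  assumes fin: "finite A"
    and diff: "\<And>x y. x \<in> A \<Longrightarrow> y \<in> A \<Longrightarrow> x - y \<in> A"
    and f: "\<And>x y. x \<in> A \<Longrightarrow> y \<in> A \<Longrightarrow> f (x - y) = f x - f y"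
  shows "card A = card (f ` A) * card {x\<in>A. f x = 0}"
proof -
  have "card {x\<in>A. f x = y} = card {x\<in>A. f x = 0}" if "y \<in> f ` A" for y
  proof -
    from that obtain z where z: "z \<in> A" "y = f z" by auto
    have "0 \<in> A" using diff[OF z(1) z(1)] by simp
    then have neg: "- z \<in> A" and fneg: "f (- z) = - f z"
      using diff[of 0 z] f[of 0 z] f[of z z] f[of 0 0] z by auto
    \<comment> \<open>The inverse translation is written \<open>x - - z\<close> so that closure and
      additivity, both stated for differences, apply to it.\<close>
    have "bij_betw (\<lambda>x. x - z) {x\<in>A. f x = y} {x\<in>A. f x = 0}"
    proof (rule bij_betwI[of _ _ _ "\<lambda>x. x - - z"])
      show "(\<lambda>x. x - - z) \<in> {x\<in>A. f x = 0} \<rightarrow> {x\<in>A. f x = y}"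
        using diff f neg fneg z by fastforce
    qed (use diff f z in auto)
    then show ?thesis by (rule bij_betw_same_card)
  qed
  moreover have "card A = (\<Sum>y\<in>f ` A. card {x\<in>A. f x = y})"
    using sum.image_gen[OF fin, of "\<lambda>_. 1 :: nat" f] by simp
  ultimately show ?thesis by simp
qed

text \<open>Euclid's argument: one plus the product of all linear factors would be a nonconstant
  polynomial without roots.\<close>

lemma infinite_UNIV_alg_closed: "infinite (UNIV :: 'a::alg_closed_field set)"
proof
  assume fin: "finite (UNIV :: 'a set)"
  define p :: "'a poly" where "p = (\<Prod>a\<in>UNIV. [:- a, 1:])"
  have "Polynomial.degree p = card (UNIV :: 'a set)"
    unfolding p_def by (subst degree_prod_sum_eq) auto
  then have "Polynomial.degree (p + 1) > 0"
    using fin by (simp add: degree_add_eq_left finite_UNIV_card_ge_0)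
  then obtain x where "poly (p + 1) x = 0"
    using alg_closed_imp_poly_has_root by blast
  moreover have "poly p x = 0"
    using fin by (auto simp: p_def poly_prod)
  ultimately show False by simp
qed

text \<open>Unique coordinates identify vectors with extensional functions on the basis. It is
  applied both to column spaces and to the torsion.\<close>

lemma (in vectorspace) card_carrier_eq_power_basis:
  assumes "finite A" "basis A"
  shows "card (carrier V) = card (carrier K) ^ card A"
proof -
  have A: "A \<subseteq> carrier V" using assms(2) by (simp add: basis_def)
  have ex1: "\<exists>!a. a \<in> A \<rightarrow>\<^sub>E carrier K \<and> lincomb a A = v" if "v \<in> carrier V" for v
    using basis_criterion[OF assms(1) A] assms(2) that by blast
  have closed: "lincomb a A \<in> carrier V" if "a \<in> A \<rightarrow>\<^sub>E carrier K" for a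
    using that A by (intro lincomb_closed) auto
  have "bij_betw (\<lambda>a. lincomb a A) (A \<rightarrow>\<^sub>E carrier K) (carrier V)"
  proof (rule bij_betw_imageI)
    show "inj_on (\<lambda>a. lincomb a A) (A \<rightarrow>\<^sub>E carrier K)"
      using ex1 closed by (intro inj_onI) metis
    show "(\<lambda>a. lincomb a A) ` (A \<rightarrow>\<^sub>E carrier K) = carrier V"
      using ex1 closed by blast
  qed
  then have "card (carrier V) = card (A \<rightarrow>\<^sub>E carrier K)"
    by (simp add: bij_betw_same_card)
  with assms(1) show ?thesis by (simp add: card_PiE)
qed

text \<open>The range is the column span, and the rank is its dimension; this is how ranks turn into
  cardinalities.\<close>

lemma card_range_mult_mat_vec:
  fixes A :: "'a::{field,finite} mat"
  assumes A: "A \<in> carrier_mat n nc"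
  shows "card ((\<lambda>v. A *\<^sub>v v) ` carrier_vec nc) = CARD('a) ^ vec_space.rank n A"
proof -
  interpret vec_space "TYPE('a)" n .
  have vs: "vectorspace class_ring (span_vs (set (cols A)))"
    using A by (intro subspace_is_vs span_is_subspace) (auto simp: cols_def)
  obtain B where B: "finite B" "vectorspace.basis class_ring (span_vs (set (cols A))) B"
    using vectorspace.finite_basis_exists[OF vs fin_dim_span_cols[OF A]] by blast
  have "card B = rank A"
    unfolding rank_def by (rule vectorspace.dim_basis[OF vs B, symmetric])
  then have "card (span (set (cols A))) = CARD('a) ^ rank A"
    using vectorspace.card_carrier_eq_power_basis[OF vs B] by simp
  moreover have "span (set (cols A)) = (\<lambda>v. A *\<^sub>v v) ` carrier_vec nc"
  proof -
    have "A *\<^sub>v x \<in> carrier_vec n" for x using A by (intro carrier_vecI) auto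
    then show ?thesis
      unfolding col_space_eq[OF A, unfolded col_space_def carrier_matD[OF A]] by blast
  qed
  ultimately show ?thesis by simp
qed

lemma card_carrier_mat: "card (carrier_mat n k :: 'a::finite mat set) = CARD('a) ^ (n * k)"
  and finite_carrier_mat: "finite (carrier_mat n k :: 'a::finite mat set)"
proof -
  have "bij_betw (\<lambda>g. mat n k g) (({..<n} \<times> {..<k}) \<rightarrow>\<^sub>E UNIV) (carrier_mat n k :: 'a mat set)"
    by (rule bij_betwI[of _ _ _ "\<lambda>A. \<lambda>ij\<in>{..<n} \<times> {..<k}. A $$ ij"])
       (auto simp: fun_eq_iff PiE_def extensional_def)
  moreover have "finite (({..<n} \<times> {..<k}) \<rightarrow>\<^sub>E (UNIV :: 'a set))"
    by (intro finite_PiE) auto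
  ultimately show "card (carrier_mat n k :: 'a mat set) = CARD('a) ^ (n * k)"
    "finite (carrier_mat n k :: 'a mat set)"
    by (auto simp: card_PiE card_cartesian_product bij_betw_finite dest!: bij_betw_same_card)
qed

text \<open>The zero polynomial has degree 0, so for \<open>n = 0\<close> the set is empty although
  the formula would give 1.\<close>

lemma card_degree_less:
  assumes "0 < n"
  shows "card {f :: 'a::{finite,comm_ring_1} poly. Polynomial.degree f < n} = CARD('a) ^ n"
    and "finite {f :: 'a poly. Polynomial.degree f < n}"
proof -
  have coeff: "Polynomial.coeff (\<Sum>i<n. Polynomial.monom (g i) i) j = (if j < n then g j else 0)"
    for g :: "nat \<Rightarrow> 'a" and j
    by (simp add: coeff_sum)
  have "bij_betw (\<lambda>g. \<Sum>i<n. Polynomial.monom (g i) i) ({..<n} \<rightarrow>\<^sub>E UNIV)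
      {f :: 'a poly. Polynomial.degree f < n}"
  proof (rule bij_betwI[of _ _ _ "\<lambda>f. \<lambda>i\<in>{..<n}. Polynomial.coeff f i"])
    show "(\<lambda>g. \<Sum>i<n. Polynomial.monom (g i) i) \<in>
        ({..<n} \<rightarrow>\<^sub>E UNIV) \<rightarrow> {f :: 'a poly. Polynomial.degree f < n}"
      using assms by (intro funcsetI CollectI degree_lessI) (simp_all add: coeff)
    show "(\<lambda>f. \<lambda>i\<in>{..<n}. Polynomial.coeff f i) \<in>
        {f :: 'a poly. Polynomial.degree f < n} \<rightarrow> ({..<n} \<rightarrow>\<^sub>E UNIV)"
      by simp
  next
    fix g :: "nat \<Rightarrow> 'a" assume "g \<in> {..<n} \<rightarrow>\<^sub>E UNIV"
    then show "(\<lambda>i\<in>{..<n}. Polynomial.coeff (\<Sum>i<n. Polynomial.monom (g i) i) i) = g"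
      by (intro ext) (auto simp: coeff PiE_def extensional_def)
  next
    fix f :: "'a poly" assume "f \<in> {f. Polynomial.degree f < n}"
    then show "(\<Sum>i<n. Polynomial.monom ((\<lambda>i\<in>{..<n}. Polynomial.coeff f i) i) i) = f"
      by (intro poly_eqI) (simp add: coeff coeff_eq_0)
  qed
  moreover have "finite ({..<n} \<rightarrow>\<^sub>E (UNIV :: 'a set))"
    by (intro finite_PiE) auto
  ultimately show "card {f :: 'a poly. Polynomial.degree f < n} = CARD('a) ^ n"
    "finite {f :: 'a poly. Polynomial.degree f < n}"
    by (auto simp: card_PiE bij_betw_finite dest!: bij_betw_same_card)
qed

lemma class_ring_coset_eq:
  "PIdl\<^bsub>class_ring\<^esub> p +>\<^bsub>class_ring\<^esub> u = {v. p dvd v - u}" for p u :: "'a::comm_ring_1"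
  by (auto simp: cgenideal_def a_r_coset_def' dvd_def algebra_simps)


section \<open>The action of skew polynomials\<close>

text \<open>That \<open>q\<close> is a prime power is encoded by its being the cardinality of a
  finite field \<open>'f\<close>.\<close>

locale frobenius_tower =
  fixes \<iota> :: "'f::{field,finite} \<Rightarrow> 'k::{field,finite}" and q r :: nat
  assumes card_f: "CARD('f) = q" and card_k: "CARD('k) = q ^ r" and hom: "field_hom \<iota>"
begin

sublocale \<iota>: field_hom \<iota> by (rule hom)

lemma q_ge_2: "2 \<le> q"
proof -
  have "card {0, 1 :: 'f} \<le> CARD('f)" by (rule card_mono) auto
  then show ?thesis by (simp add: card_f)
qed

lemma q_pos [simp]: "0 < q" using q_ge_2 by simp

text \<open>The inner binomial coefficients vanish in \<open>'f\<close>, hence also in the closure,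
  to which \<open>\<iota>\<close> and \<open>to_ac\<close> carry them.\<close>

lemma frob_add1: "(x + y :: 'k alg_closure) ^ q = x ^ q + y ^ q"
proof -
  have 0: "of_nat (q choose i) = (0 :: 'k alg_closure)" if "0 < i" "i < q" for i
  proof -
    have "to_ac (\<iota> (of_nat (q choose i))) = 0"
      using finite_field_card_choose_eq_0[where 'a = 'f, of i] that by (simp add: card_f)
    then show ?thesis by (simp add: \<iota>.hom_of_nat del: of_nat_eq_0_iff_char_dvd)
  qed
  have "(x + y) ^ q = (\<Sum>i\<le>q. of_nat (q choose i) * x ^ i * y ^ (q - i))"
    by (rule binomial_ring)
  also have "\<dots> = (\<Sum>i\<in>{0, q}. of_nat (q choose i) * x ^ i * y ^ (q - i))"
    by (rule sum.mono_neutral_right) (auto simp: 0)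
  also have "\<dots> = x ^ q + y ^ q" using q_ge_2 by (simp add: add.commute)
  finally show ?thesis .
qed

lemma frob_add: "(x + y :: 'k alg_closure) ^ (q ^ i) = x ^ (q ^ i) + y ^ (q ^ i)"
  by (induction i arbitrary: x y) (simp_all add: power_mult frob_add1)

lemma frob_sum: "(\<Sum>i\<in>I. f i :: 'k alg_closure) ^ (q ^ n) = (\<Sum>i\<in>I. f i ^ (q ^ n))"
  by (induction I rule: infinite_finite_induct) (simp_all add: frob_add)

abbreviation act :: "'k poly \<Rightarrow> 'k alg_closure \<Rightarrow> 'k alg_closure" where
  "act \<equiv> skew_act q"

abbreviation smult_skew :: "'k poly \<Rightarrow> 'k poly \<Rightarrow> 'k poly" (infixl "\<star>" 70) where
  "f \<star> g \<equiv> skew_mult q f g"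

text \<open>Padding with zero coefficients lets skew polynomials of different degrees be summed over
  a common range.\<close>

lemma act_altdef:
  assumes "Polynomial.degree f \<le> N"
  shows "act f x = (\<Sum>i\<le>N. to_ac (Polynomial.coeff f i) * x ^ (q ^ i))"
  unfolding skew_act_def using assms
  by (intro sum.mono_neutral_left) (auto simp: coeff_eq_0)

lemma act_padd: "act (f + g) x = act f x + act g x"
proof -
  let ?N = "max (Polynomial.degree f) (Polynomial.degree g)"
  show ?thesis
    using act_altdef[of f ?N x] act_altdef[of g ?N x] act_altdef[of "f + g" ?N x]
      degree_add_le_max[of f g]
    by (simp only: max.cobounded1 max.cobounded2 coeff_add to_ac_add distrib_right sum.distrib simp_thms)
qed

lemma act_p0 [simp]: "act 0 x = 0" by (simp add: skew_act_def)

lemma act_puminus: "act (- f) x = - act f x"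
  using act_padd[of f "- f" x] by (simp add: add_eq_0_iff)

lemma act_pdiff: "act (f - g) x = act f x - act g x"
  using act_padd[of f "- g" x] by (simp add: act_puminus)

lemma act_psum: "act (\<Sum>i\<in>I. f i) x = (\<Sum>i\<in>I. act (f i) x)"
  by (induction I rule: infinite_finite_induct) (simp_all add: act_padd)

lemma act_monom: "act (Polynomial.monom c n) x = to_ac c * x ^ (q ^ n)"
proof -
  have "act (Polynomial.monom c n) x =
      (\<Sum>i\<le>n. to_ac (Polynomial.coeff (Polynomial.monom c n) i) * x ^ (q ^ i))"
    by (rule act_altdef) (rule degree_monom_le)
  also have "\<dots> = (\<Sum>i\<in>{n}. to_ac (Polynomial.coeff (Polynomial.monom c n) i) * x ^ (q ^ i))"
    by (rule sum.mono_neutral_right) auto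
  finally show ?thesis by simp
qed

lemma act_1 [simp]: "act 1 x = x"
  using act_monom[of 1 0 x] by simp

lemma act_add: "act f (x + y) = act f x + act f y"
  by (simp add: skew_act_def frob_add ring_distribs sum.distrib)

lemma act_0 [simp]: "act f 0 = 0"
  using act_add[of f 0 0] by (metis add_cancel_left_left add_0)

lemma act_uminus: "act f (- x) = - act f x"
  using act_add[of f x "- x"] by (simp add: add_eq_0_iff)

lemma act_diff: "act f (x - y) = act f x - act f y"
  using act_add[of f x "- y"] by (simp add: act_uminus)

lemma act_sum: "act f (\<Sum>i\<in>I. g i) = (\<Sum>i\<in>I. act f (g i))"
  by (induction I rule: infinite_finite_induct) (simp_all add: act_add)

text \<open>The twist \<open>b ^ q ^ i\<close> in the product is what the outer Frobenius power does
  to an inner coefficient; \<open>frob_sum\<close> distributes that power over the inner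
  sum.\<close>

lemma act_mult: "act (f \<star> g) x = act f (act g x)"
proof -
  have "to_ac (a * b ^ q ^ i) * x ^ q ^ (i + j) = to_ac a * (to_ac b * x ^ q ^ j) ^ q ^ i" for a b i j
    by (simp add: power_add power_mult power_mult_distrib mult.assoc mult.commute[of "q ^ i"])
  then have "act (f \<star> g) x = (\<Sum>i\<le>Polynomial.degree f. to_ac (Polynomial.coeff f i) *
      (\<Sum>j\<le>Polynomial.degree g. (to_ac (Polynomial.coeff g j) * x ^ q ^ j) ^ q ^ i))"
    by (simp only: skew_mult_def act_psum act_monom sum_distrib_left)
  also have "\<dots> = act f (act g x)"
    by (simp only: skew_act_def frob_sum)
  finally show ?thesis .
qed


subsection \<open>Zeros, right division and the gcrd\<close>

definition ker :: "'k poly \<Rightarrow> 'k alg_closure set" where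
  "ker f = {x. act f x = 0}"

text \<open>The action of \<open>f\<close> is evaluation of the ordinary linearized polynomial with
  exponents \<open>q ^ i\<close>, so the usual root bound applies.\<close>

lemma finite_ker: "f \<noteq> 0 \<Longrightarrow> finite (ker f)"
  and card_ker_le: "f \<noteq> 0 \<Longrightarrow> card (ker f) \<le> q ^ Polynomial.degree f"
proof -
  assume "f \<noteq> 0"
  define P where
    "P = (\<Sum>i\<le>Polynomial.degree f. Polynomial.monom (to_ac (Polynomial.coeff f i)) (q ^ i))"
  have poly_P: "poly P x = act f x" for x
    by (simp add: P_def skew_act_def poly_sum poly_monom)
  \<comment> \<open>As \<open>q\<close> is at least 2, the exponents \<open>q ^ i\<close> are
    distinct, so the top coefficient receives a single contribution.\<close>
  have "Polynomial.coeff P (q ^ Polynomial.degree f) =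
      (\<Sum>i\<in>{Polynomial.degree f}. to_ac (Polynomial.coeff f i))"
    unfolding P_def coeff_sum using q_ge_2
    by (intro sum.mono_neutral_cong_right) (auto simp: coeff_monom)
  then have "P \<noteq> 0" using \<open>f \<noteq> 0\<close> by auto
  have "Polynomial.degree P \<le> q ^ Polynomial.degree f"
    unfolding P_def
    by (rule degree_sum_le) (auto intro!: order_trans[OF degree_monom_le] power_increasing simp: Suc_le_eq)
  with card_poly_roots_bound[OF \<open>P \<noteq> 0\<close>] poly_roots_finite[OF \<open>P \<noteq> 0\<close>]
  show "finite (ker f)" "card (ker f) \<le> q ^ Polynomial.degree f"
    by (simp_all add: ker_def poly_P)
qed

lemma act_eq_0_imp:
  assumes "\<And>x. act f x = 0" shows "f = 0"
proof (rule ccontr)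
  assume "f \<noteq> 0"
  from finite_ker[OF this] show False
    using assms infinite_UNIV_alg_closed by (auto simp: ker_def)
qed

text \<open>Through this the ring laws of R are inherited from composition of additive maps, without
  computing coefficients.\<close>

lemma act_inject: "(\<And>x. act f x = act g x) \<Longrightarrow> f = g"
  using act_eq_0_imp[of "f - g"] by (simp add: act_pdiff)

lemma skew_assoc: "f \<star> g \<star> h = f \<star> (g \<star> h)"
  by (rule act_inject) (simp add: act_mult)

lemma skew_distrib_right: "(f + g) \<star> h = f \<star> h + g \<star> h"
  by (rule act_inject) (simp add: act_mult act_padd)

lemma skew_distrib_left: "f \<star> (g + h) = f \<star> g + f \<star> h"
  by (rule act_inject) (simp add: act_mult act_padd act_add)

lemma skew_diff_right: "(f - g) \<star> h = f \<star> h - g \<star> h"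
  by (rule act_inject) (simp add: act_mult act_pdiff)

lemma skew_one [simp]: "1 \<star> f = f" "f \<star> 1 = f"
  by (rule act_inject; simp add: act_mult)+

lemma skew_zero [simp]: "0 \<star> f = 0" "f \<star> 0 = 0"
  by (rule act_inject; simp add: act_mult)+

lemma ring_skew_ring: "ring (skew_ring q :: 'k poly ring)"
proof -
  have "\<exists>y. y + x = 0" "\<exists>y. x + y = 0" for x :: "'k poly"
    by (rule exI[of _ "- x"]; simp)+
  then show ?thesis
    by unfold_locales
       (auto simp: skew_ring_def skew_assoc skew_distrib_left skew_distrib_right Units_def add_ac)
qed

section \<open>Degrees, leading coefficients and division with remainder\<close>

lemma coeff_skew_mult:
  "Polynomial.coeff (f \<star> g) n = (\<Sum>i\<le>Polynomial.degree f. \<Sum>j\<le>Polynomial.degree g.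
     if i + j = n then Polynomial.coeff f i * Polynomial.coeff g j ^ (q ^ i) else 0)"
  by (simp add: skew_mult_def coeff_sum)

lemma coeff_skew_mult_gt:
  "n > Polynomial.degree f + Polynomial.degree g \<Longrightarrow> Polynomial.coeff (f \<star> g) n = 0"
  by (auto simp: coeff_skew_mult intro!: sum.neutral)

lemma degree_skew_mult_le: "Polynomial.degree (f \<star> g) \<le> Polynomial.degree f + Polynomial.degree g"
  by (rule degree_le) (simp add: coeff_skew_mult_gt)

lemma coeff_skew_mult_degree:
  "Polynomial.coeff (f \<star> g) (Polynomial.degree f + Polynomial.degree g) =
     lead_coeff f * lead_coeff g ^ (q ^ Polynomial.degree f)"
proof -
  let ?m = "Polynomial.degree f" and ?n = "Polynomial.degree g"
  have "Polynomial.coeff (f \<star> g) (?m + ?n) = (\<Sum>i\<in>{?m}. \<Sum>j\<le>?n.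
     if i + j = ?m + ?n then Polynomial.coeff f i * Polynomial.coeff g j ^ (q ^ i) else 0)"
    unfolding coeff_skew_mult
    by (rule sum.mono_neutral_right) (auto intro!: sum.neutral)
  then show ?thesis by simp
qed

lemma degree_skew_mult:
  assumes "f \<noteq> 0" "g \<noteq> 0"
  shows "Polynomial.degree (f \<star> g) = Polynomial.degree f + Polynomial.degree g"
proof (rule antisym[OF degree_skew_mult_le le_degree])
  show "Polynomial.coeff (f \<star> g) (Polynomial.degree f + Polynomial.degree g) \<noteq> 0"
    using assms by (simp add: coeff_skew_mult_degree)
qed

lemma lead_coeff_skew_mult:
  "lead_coeff (f \<star> g) = lead_coeff f * lead_coeff g ^ (q ^ Polynomial.degree f)"
proof (cases "f = 0 \<or> g = 0")
  case False
  then show ?thesis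
    by (simp add: degree_skew_mult coeff_skew_mult_degree)
qed (auto simp: zero_power)

lemma right_division:
  assumes "g \<noteq> 0"
  shows "\<exists>h s. f = h \<star> g + s \<and> (s = 0 \<or> Polynomial.degree s < Polynomial.degree g)"
proof (induction "Polynomial.degree f" arbitrary: f rule: less_induct)
  case less
  show ?case
  proof (cases "f = 0 \<or> Polynomial.degree f < Polynomial.degree g")
    case True
    then have "f = 0 \<star> g + f" by simp
    with True show ?thesis by blast
  next
    case False
    define d where "d = Polynomial.degree f - Polynomial.degree g"
    \<comment> \<open>Left multiplication by \<tau>^d raises the leading coefficient of
      \<open>g\<close> to the power \<open>q ^ d\<close>, which must be divided out.\<close>
    define c where "c = Polynomial.monom (lead_coeff f / lead_coeff g ^ (q ^ d)) d"
    have c: "Polynomial.degree c = d" "lead_coeff c = lead_coeff f / lead_coeff g ^ (q ^ d)"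
      using False assms by (simp_all add: c_def degree_monom_eq)
    have deg: "d + Polynomial.degree g = Polynomial.degree f"
      using False by (simp add: d_def)
    have "Polynomial.degree (c \<star> g) \<le> Polynomial.degree f"
      using degree_skew_mult_le[of c g] c deg by simp
    moreover have "Polynomial.coeff (c \<star> g) (Polynomial.degree f) = lead_coeff f"
      using coeff_skew_mult_degree[of c g] c deg assms by simp
    \<comment> \<open>For \<open>f\<close> of degree 0 the degree cannot drop further, so
      cancellation to zero is a separate alternative.\<close>
    ultimately have "f - c \<star> g = 0 \<or> Polynomial.degree (f - c \<star> g) < Polynomial.degree f"
      by (metis coeff_diff degree_diff_le diff_self eq_zero_or_degree_less order_refl)
    then obtain h s where "f - c \<star> g = h \<star> g + s" "s = 0 \<or> Polynomial.degree s < Polynomial.degree g"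
    proof
      assume "f - c \<star> g = 0"
      then show ?thesis using that[of 0 0] by simp
    next
      assume "Polynomial.degree (f - c \<star> g) < Polynomial.degree f"
      then show ?thesis using less that by blast
    qed
    then have "f = (c + h) \<star> g + s" by (simp add: skew_distrib_right algebra_simps)
    with \<open>s = 0 \<or> _\<close> show ?thesis by blast
  qed
qed

text \<open>The left ideal generated by \<open>f\<close> and \<open>g\<close> is principal: division
  by a nonzero element of least degree leaves a remainder in the ideal, which must vanish.\<close>

lemma gcrd_exists:
  assumes "f \<noteq> 0"
  shows "\<exists>d a b. lead_coeff d = 1 \<and> d = a \<star> f + b \<star> g \<and> right_dvd q d f \<and> right_dvd q d g"
proof -
  define I where "I = {a \<star> f + b \<star> g |a b. True}"
  have f: "f \<in> I" unfolding I_def by (rule CollectI, rule exI[of _ 1], rule exI[of _ 0]) simp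
  have g: "g \<in> I" unfolding I_def by (rule CollectI, rule exI[of _ 0], rule exI[of _ 1]) simp
  have diff: "x - y \<in> I" if "x \<in> I" "y \<in> I" for x y
  proof -
    from that obtain a b a' b' where "x = a \<star> f + b \<star> g" "y = a' \<star> f + b' \<star> g"
      unfolding I_def by blast
    then have "x - y = (a - a') \<star> f + (b - b') \<star> g" by (simp add: skew_diff_right)
    then show ?thesis unfolding I_def by blast
  qed
  have mult: "c \<star> x \<in> I" if "x \<in> I" for c x
  proof -
    from that obtain a b where "x = a \<star> f + b \<star> g" unfolding I_def by blast
    then have "c \<star> x = (c \<star> a) \<star> f + (c \<star> b) \<star> g" by (simp add: skew_distrib_left skew_assoc)
    then show ?thesis unfolding I_def by blast
  qed
  obtain e where e: "e \<in> I" "e \<noteq> 0"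
    and min: "\<And>x. x \<in> I \<Longrightarrow> x \<noteq> 0 \<Longrightarrow> Polynomial.degree e \<le> Polynomial.degree x"
    using exists_least_iff[of "\<lambda>n. \<exists>x. x \<in> I \<and> x \<noteq> 0 \<and> Polynomial.degree x = n"] f assms
    by (metis not_less)
  \<comment> \<open>A constant left factor does not twist the leading coefficient of
    \<open>e\<close>, so this scaling is monic.\<close>
  define d where "d = [:1 / lead_coeff e:] \<star> e"
  have d: "lead_coeff d = 1" "d \<in> I"
    using e mult by (simp_all add: d_def lead_coeff_skew_mult)
  then have "d \<noteq> 0" by auto
  have deg_d: "Polynomial.degree d = Polynomial.degree e"
    using e by (simp add: d_def degree_skew_mult)
  have dvd: "right_dvd q d x" if "x \<in> I" for x
  proof -
    obtain h s where hs: "x = h \<star> d + s" "s = 0 \<or> Polynomial.degree s < Polynomial.degree d"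
      using right_division[OF \<open>d \<noteq> 0\<close>] by blast
    have "s = x - h \<star> d" using hs by simp
    then have "s \<in> I" using that d mult diff by simp
    then have "s = 0" using min[of s] hs(2) deg_d by fastforce
    then show ?thesis using hs by (auto simp: right_dvd_def)
  qed
  show ?thesis using d dvd f g unfolding I_def by blast
qed

text \<open>The cofactor has degree 0 and is monic, hence is 1. This gives the uniqueness behind
  \<open>THE\<close> in \<open>gcrd\<close>.\<close>

lemma right_dvd_antisym:
  fixes c d :: "'k poly"
  assumes "lead_coeff c = 1" "lead_coeff d = 1" "right_dvd q c d" "right_dvd q d c"
  shows "c = d"
proof -
  obtain h k where h: "d = h \<star> c" and k: "c = k \<star> d" using assms by (auto simp: right_dvd_def)
  have "h \<noteq> 0" "k \<noteq> 0" "c \<noteq> 0" "d \<noteq> 0" using h k assms(1,2) by auto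
  then have "Polynomial.degree d = Polynomial.degree h + Polynomial.degree c"
    "Polynomial.degree c = Polynomial.degree k + Polynomial.degree d"
    using degree_skew_mult h k by metis+
  then have "Polynomial.degree h = 0" by simp
  moreover have "lead_coeff h = 1" using lead_coeff_skew_mult[of h c] h assms(1,2) by simp
  ultimately have "h = 1" by (metis degree_eq_zeroE lead_coeff_pCons(2) one_pCons)
  then show ?thesis using h by simp
qed

lemma gcrd_props:
  assumes "f \<noteq> 0"
  shows "lead_coeff (gcrd q f g) = 1" "right_dvd q (gcrd q f g) f" "right_dvd q (gcrd q f g) g"
    "\<exists>a b. gcrd q f g = a \<star> f + b \<star> g"
proof -
  obtain d a b where d: "lead_coeff d = 1" "d = a \<star> f + b \<star> g" "right_dvd q d f" "right_dvd q d g"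
    using gcrd_exists[OF assms] by blast
  have max: "right_dvd q c d" if "right_dvd q c f" "right_dvd q c g" for c
  proof -
    from that obtain x y where "f = x \<star> c" "g = y \<star> c" by (auto simp: right_dvd_def)
    then have "d = (a \<star> x + b \<star> y) \<star> c" using d(2) by (simp add: skew_assoc skew_distrib_right)
    then show ?thesis by (auto simp: right_dvd_def)
  qed
  have "gcrd q f g = d"
    unfolding gcrd_def using d max right_dvd_antisym by (intro the_equality) blast+
  with d show "lead_coeff (gcrd q f g) = 1" and "right_dvd q (gcrd q f g) f"
    and "right_dvd q (gcrd q f g) g" and "\<exists>a b. gcrd q f g = a \<star> f + b \<star> g" by auto
qed

section \<open>Kernels and right divisibility\<close>

lemma ker_right_dvd: "right_dvd q d f \<Longrightarrow> ker d \<subseteq> ker f"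
  by (auto simp: right_dvd_def ker_def act_mult)

lemma ker_gcrd: "f \<noteq> 0 \<Longrightarrow> ker (gcrd q f g) = ker f \<inter> ker g"
  using ker_right_dvd[OF gcrd_props(2)[of f g]] ker_right_dvd[OF gcrd_props(3)[of f g]]
    gcrd_props(4)[of f g]
  by (auto simp: ker_def act_padd act_mult)

lemma ker_diff: "x \<in> ker f \<Longrightarrow> y \<in> ker f \<Longrightarrow> x - y \<in> ker f"
  by (simp add: ker_def act_diff)

lemma zero_in_ker [simp]: "0 \<in> ker f"
  by (simp add: ker_def)

text \<open>With \<open>f = h \<star> d\<close>, the map \<open>act d\<close> sends
  \<open>ker f\<close> into \<open>ker h\<close> with kernel \<open>ker d\<close>. Both factors obey
  the degree bound and their product attains it, so \<open>d\<close> attains its own.\<close>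

lemma card_ker_right_dvd:
  assumes "f \<noteq> 0" "card (ker f) = q ^ Polynomial.degree f" "right_dvd q d f"
  shows "card (ker d) = q ^ Polynomial.degree d"
proof -
  obtain h where h: "f = h \<star> d" using assms(3) by (auto simp: right_dvd_def)
  have nz: "h \<noteq> 0" "d \<noteq> 0" using assms(1) h by auto
  have "card (ker f) = card (act d ` ker f) * card {x \<in> ker f. act d x = 0}"
    by (rule card_eq_card_image_times_card_kernel)
       (use assms(1) finite_ker ker_diff in \<open>auto simp: act_diff\<close>)
  also have "{x \<in> ker f. act d x = 0} = ker d"
    using ker_right_dvd[OF assms(3)] by (auto simp: ker_def)
  also have "card (act d ` ker f) \<le> card (ker h)"
    by (rule card_mono) (use nz finite_ker in \<open>auto simp: ker_def h act_mult\<close>)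
  also have "card (ker h) \<le> q ^ Polynomial.degree h" using nz by (simp add: card_ker_le)
  finally have "q ^ Polynomial.degree h * q ^ Polynomial.degree d \<le> q ^ Polynomial.degree h * card (ker d)"
    using nz assms(2) h by (simp add: degree_skew_mult power_add)
  then have "q ^ Polynomial.degree d \<le> card (ker d)" by simp
  then show ?thesis using card_ker_le[OF nz(2)] by simp
qed

lemma card_ker_gcrd:
  assumes "f \<noteq> 0" "card (ker f) = q ^ Polynomial.degree f"
  shows "q ^ Polynomial.degree (gcrd q f g) = card (ker f \<inter> ker g)"
  using card_ker_right_dvd[OF assms gcrd_props(2)] ker_gcrd assms(1) by simp

text \<open>A converse of \<open>ker_right_dvd\<close> when \<open>f\<close> has the maximal number
  of zeros: the remainder vanishes on all of them, too many for its degree.\<close>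

lemma ker_subset_imp_right_dvd:
  assumes "f \<noteq> 0" "card (ker f) = q ^ Polynomial.degree f" "ker f \<subseteq> ker g"
  shows "right_dvd q f g"
proof -
  obtain h s where hs: "g = h \<star> f + s" "s = 0 \<or> Polynomial.degree s < Polynomial.degree f"
    using right_division[OF assms(1)] by blast
  have sub: "ker f \<subseteq> ker s"
  proof
    fix x assume "x \<in> ker f"
    moreover from this assms(3) have "x \<in> ker g" by blast
    ultimately show "x \<in> ker s" using hs(1) by (simp add: ker_def act_padd act_mult)
  qed
  have "s = 0"
  proof (rule ccontr)
    assume s: "s \<noteq> 0"
    have "q ^ Polynomial.degree f \<le> card (ker s)"
      using card_mono[OF finite_ker[OF s] sub] assms(2) by simp
    also have "\<dots> \<le> q ^ Polynomial.degree s" by (rule card_ker_le[OF s])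
    also have "\<dots> < q ^ Polynomial.degree f"
      using s hs(2) q_ge_2 by (intro power_strict_increasing) auto
    finally show False by simp
  qed
  then show ?thesis using hs by (auto simp: right_dvd_def)
qed

lemma right_dvd_small_imp_0:
  fixes d f :: "'k poly"
  assumes "right_dvd q d f" "Polynomial.degree f < Polynomial.degree d"
  shows "f = 0"
proof -
  obtain h where h: "f = h \<star> d" using assms(1) by (auto simp: right_dvd_def)
  have "h = 0 \<or> d = 0"
  proof (rule ccontr)
    assume "\<not> (h = 0 \<or> d = 0)"
    then have "Polynomial.degree f = Polynomial.degree h + Polynomial.degree d"
      by (simp add: h degree_skew_mult)
    with assms(2) show False by simp
  qed
  then show ?thesis using h by auto
qed

text \<open>\<open>PIdl\<close> consists of the left multiples of \<open>d\<close>, so congruence is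
  expressed by right divisibility.\<close>

lemma skew_coset_eq:
  "PIdl\<^bsub>skew_ring q\<^esub> d +>\<^bsub>skew_ring q\<^esub> u = {v. right_dvd q d (v - u)}" for d u :: "'k poly"
  by (auto simp: cgenideal_def a_r_coset_def' right_dvd_def skew_ring_def algebra_simps)

lemma right_dvd_add: "right_dvd q d f \<Longrightarrow> right_dvd q d g \<Longrightarrow> right_dvd q d (f + g)"
  and right_dvd_diff: "right_dvd q d f \<Longrightarrow> right_dvd q d g \<Longrightarrow> right_dvd q d (f - g)"
  for d f g :: "'k poly"
  unfolding right_dvd_def by (metis skew_distrib_right, metis skew_diff_right)

lemma skew_coset_eq_iff:
  "PIdl\<^bsub>skew_ring q\<^esub> d +>\<^bsub>skew_ring q\<^esub> u = PIdl\<^bsub>skew_ring q\<^esub> d +>\<^bsub>skew_ring q\<^esub> v \<longleftrightarrow>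
     right_dvd q d (u - v)" for d u v :: "'k poly"
proof
  assume "PIdl\<^bsub>skew_ring q\<^esub> d +>\<^bsub>skew_ring q\<^esub> u = PIdl\<^bsub>skew_ring q\<^esub> d +>\<^bsub>skew_ring q\<^esub> v"
  moreover have "right_dvd q d (u - u)"
    unfolding right_dvd_def by (rule exI[of _ 0]) simp
  ultimately have "u \<in> {w. right_dvd q d (w - v)}"
    unfolding skew_coset_eq by blast
  then show "right_dvd q d (u - v)" by simp
next
  assume uv: "right_dvd q d (u - v)"
  have "right_dvd q d (w - u) \<longleftrightarrow> right_dvd q d (w - v)" for w
    using right_dvd_add[OF _ uv, of "w - u"] right_dvd_diff[OF _ uv, of "w - v"] by auto
  then show "PIdl\<^bsub>skew_ring q\<^esub> d +>\<^bsub>skew_ring q\<^esub> u = PIdl\<^bsub>skew_ring q\<^esub> d +>\<^bsub>skew_ring q\<^esub> v"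
    unfolding skew_coset_eq by (rule Collect_cong)
qed

lemma carrier_skew_Quot:
  "carrier (skew_ring q Quot (PIdl\<^bsub>skew_ring q\<^esub> d)) =
     range (\<lambda>u :: 'k poly. PIdl\<^bsub>skew_ring q\<^esub> d +>\<^bsub>skew_ring q\<^esub> u)"
proof -
  have "carrier (skew_ring q) = (UNIV :: 'k poly set)" by (simp add: skew_ring_def)
  then show ?thesis by (simp add: FactRing_def A_RCOSETS_def' UNION_singleton_eq_range)
qed


subsection \<open>The Drinfeld module\<close>

lemma r_pos [simp]: "0 < r"
proof (rule ccontr)
  assume "\<not> 0 < r"
  then have "CARD('k) = 1" using card_k by simp
  then have "(0 :: 'k) = 1" by (metis UNIV_I card_1_singletonE singletonD)
  then show False by simp
qed

text \<open>\<tau>^r commutes with every coefficient because raising to the power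
  \<open>q ^ r\<close> is the identity on F_{q^r}.\<close>

lemma to_ac_frob [simp]: "to_ac (c :: 'k) ^ (q ^ r) = to_ac c"
  using finite_field_pow_card[of c] by (simp add: card_k flip: to_ac_power)

text \<open>Constants from F_q commute with \<tau>; together with the previous fact this makes
  \<phi>_a central.\<close>

lemma \<iota>_frob [simp]: "\<iota> c ^ (q ^ i) = \<iota> c"
  using finite_field_pow_card_pow[of c i] by (simp add: card_f flip: \<iota>.hom_power)

lemma to_ac_\<iota>_frob [simp]: "to_ac (\<iota> c) ^ (q ^ i) = to_ac (\<iota> c)"
  by (simp flip: to_ac_power)

abbreviation D :: "'f poly \<Rightarrow> 'k poly" where
  "D \<equiv> drinfeld \<iota> r"

lemma act_D:
  assumes "Polynomial.degree a \<le> N"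
  shows "act (D a) x = (\<Sum>i\<le>N. to_ac (\<iota> (Polynomial.coeff a i)) * x ^ (q ^ (r * i)))"
  unfolding drinfeld_def act_psum act_monom using assms
  by (intro sum.mono_neutral_left) (auto simp: coeff_eq_0)

lemma act_D_0 [simp]: "act (D 0) x = 0"
  by (simp add: act_D[of 0 0])

text \<open>Horner's rule, with T acting as the \<open>q ^ r\<close> power map; it drives the
  inductions on \<open>a\<close>.\<close>

lemma act_D_pCons:
  "act (D (pCons c a)) x = to_ac (\<iota> c) * x + act (D a) (x ^ (q ^ r))"
proof -
  have "act (D (pCons c a)) x =
      (\<Sum>i\<le>Suc (Polynomial.degree a).
        to_ac (\<iota> (Polynomial.coeff (pCons c a) i)) * x ^ (q ^ (r * i)))"
    by (rule act_D) (simp add: degree_pCons_le)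
  also have "\<dots> = to_ac (\<iota> c) * x + act (D a) (x ^ (q ^ r))"
    by (subst sum.atMost_Suc_shift) (simp add: act_D[of a "Polynomial.degree a"] power_add power_mult)
  finally show ?thesis .
qed

lemma act_D_smult: "act (D (Polynomial.smult c a)) x = to_ac (\<iota> c) * act (D a) x"
  by (simp add: act_D[where N = "Polynomial.degree a"] degree_smult_le sum_distrib_left mult.assoc
      \<iota>.hom_mult)

lemma D_add: "D (a + b) = D a + D b"
proof (rule act_inject)
  fix x
  let ?N = "max (Polynomial.degree a) (Polynomial.degree b)"
  show "act (D (a + b)) x = act (D a + D b) x"
    using act_D[of a ?N x] act_D[of b ?N x] act_D[of "a + b" ?N x] degree_add_le_max[of a b]
    by (simp add: act_padd \<iota>.hom_add distrib_right sum.distrib)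
qed

lemma act_commutes_frob: "act f (x ^ (q ^ r)) = act f x ^ (q ^ r)"
  by (simp add: skew_act_def frob_sum power_mult_distrib mult.commute flip: power_mult)

lemma act_commutes_\<iota>: "act f (to_ac (\<iota> c) * x) = to_ac (\<iota> c) * act f x"
  by (simp add: skew_act_def power_mult_distrib sum_distrib_left mult.left_commute)

text \<open>A is generated by F_q and T, so the two preceding commutations suffice. Centrality of
  the Q_i, stability of the torsion under R and A-linearity of the induced maps all come from
  here.\<close>

lemma act_D_commute: "act f (act (D a) x) = act (D a) (act f x)"
  by (induction a arbitrary: x)
     (simp_all add: act_D_pCons act_add act_commutes_\<iota> act_commutes_frob)

lemma act_D_mult: "act (D (a * b)) x = act (D a) (act (D b) x)"
proof (induction a arbitrary: x)
  case (pCons c a)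
  then show ?case
    by (simp add: D_add act_padd act_D_smult act_D_pCons act_commutes_frob)
qed simp

lemma D_mult: "D (a * b) = D a \<star> D b"
  by (rule act_inject) (simp add: act_D_mult act_mult)

lemma D_central: "f \<star> D a = D a \<star> f"
  by (rule act_inject) (simp add: act_mult act_D_commute)

lemma D_1 [simp]: "D 1 = 1"
  by (rule act_inject) (use act_D_pCons[of 1 0] in \<open>simp flip: one_pCons\<close>)

lemma coeff_D: "Polynomial.coeff (D a) (r * n) = \<iota> (Polynomial.coeff a n)"
proof -
  have "Polynomial.coeff (D a) (r * n) =
      (\<Sum>i\<le>Polynomial.degree a. if i = n then \<iota> (Polynomial.coeff a i) else 0)"
    \<comment> \<open>Positivity of \<open>r\<close> makes the exponents \<open>r * i\<close>
      distinct.\<close>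
    unfolding drinfeld_def coeff_sum by (rule sum.cong) (use r_pos in \<open>auto simp del: r_pos\<close>)
  then show ?thesis by (auto simp: coeff_eq_0)
qed

lemma degree_D: "Polynomial.degree (D a) = r * Polynomial.degree a"
proof (rule antisym)
  show "Polynomial.degree (D a) \<le> r * Polynomial.degree a"
    unfolding drinfeld_def
    by (rule degree_sum_le) (auto intro!: order_trans[OF degree_monom_le])
  show "r * Polynomial.degree a \<le> Polynomial.degree (D a)"
    by (cases "a = 0") (auto intro!: le_degree simp: coeff_D)
qed

lemma lead_coeff_D: "lead_coeff (D a) = \<iota> (lead_coeff a)"
  by (simp add: degree_D coeff_D)

lemma D_eq_0_iff [simp]: "D a = 0 \<longleftrightarrow> a = 0"
  using lead_coeff_D[of a] by (metis \<iota>.hom_0_iff leading_coeff_0_iff)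

lemma act_in_ker_D: "x \<in> ker (D a) \<Longrightarrow> act f x \<in> ker (D a)"
  by (simp add: ker_def flip: act_D_commute)

lemma torsion_eq_ker: "torsion q \<iota> r a = ker (D a)"
  by (simp add: torsion_def ker_def)

text \<open>If $sa + tb = 1$, then $\phi_a$ maps $\ker Y \cap \phi[ab]$ onto $\ker Y \cap \phi[b]$: a
  preimage of $y$ is $\phi_s(y)$.\<close>

lemma card_ker_Int_ker_D_mult:
  assumes st: "s * a + t * b = 1" and nz: "a * b \<noteq> 0"
  shows "card (ker Y \<inter> ker (D (a * b))) = card (ker Y \<inter> ker (D a)) * card (ker Y \<inter> ker (D b))"
proof -
  let ?A = "ker Y \<inter> ker (D (a * b))"
  have "card ?A = card (act (D a) ` ?A) * card {x \<in> ?A. act (D a) x = 0}"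
    by (rule card_eq_card_image_times_card_kernel)
       (use nz finite_ker[of "D (a * b)"] in \<open>auto simp: ker_diff act_diff\<close>)
  also have "{x \<in> ?A. act (D a) x = 0} = ker Y \<inter> ker (D a)"
    by (auto simp: ker_def act_D_mult mult.commute[of a b])
  also have "act (D a) ` ?A = ker Y \<inter> ker (D b)"
  proof
    show "act (D a) ` ?A \<subseteq> ker Y \<inter> ker (D b)"
      using act_D_commute[of Y a] act_D_mult[of b a]
      by (auto simp: ker_def mult.commute[of a b])
    show "ker Y \<inter> ker (D b) \<subseteq> act (D a) ` ?A"
    proof
      fix y assume y: "y \<in> ker Y \<inter> ker (D b)"
      have "act (D (s * a + t * b)) y = y" by (simp add: st)
      then have eq: "act (D s) (act (D a) y) = y"
        using y by (simp add: D_add act_padd act_D_mult ker_def)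
      have "act (D s) y \<in> ?A"
        using y act_D_commute[of Y s y] act_D_commute[of "D (a * b)" s y] act_D_mult[of a b y]
        by (simp add: ker_def)
      moreover have "y = act (D a) (act (D s) y)" using eq act_D_commute[of "D s" a y] by simp
      ultimately show "y \<in> act (D a) ` ?A" by blast
    qed
  qed
  finally show ?thesis by simp
qed

text \<open>Multiplicativity of \<phi> turns the ordered product \<Pi> into \<phi> of a commutative
  product in A.\<close>

lemma skew_Prod_D: "skew_Prod q l (\<lambda>i. D (\<qq> i)) = D (\<Prod>i<l. \<qq> i)"
proof -
  have "foldr (\<lambda>i. skew_mult q (D (\<qq> i))) xs 1 = D (prod_list (map \<qq> xs))" for xs :: "nat list"
    by (induction xs) (simp_all add: D_mult)
  then show ?thesis
    by (simp add: skew_Prod_def prod.distinct_set_conv_list[symmetric] atLeast0LessThan)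
qed

section \<open>The quotient rings R/(Q_i)\<close>

lemma skew_ring_simps:
  "carrier (skew_ring q) = UNIV" "add (skew_ring q) = (+)" "monoid.mult (skew_ring q) = skew_mult q"
  "zero (skew_ring q) = 0"
  by (simp_all add: skew_ring_def)

text \<open>Closure under right multiplication is where centrality enters: \<open>D a\<close> moves
  past the right factor.\<close>

lemma ideal_D: "ideal (PIdl\<^bsub>skew_ring q\<^esub> (D a)) (skew_ring q)"
proof -
  interpret ring "skew_ring q :: 'k poly ring" by (rule ring_skew_ring)
  have I: "PIdl\<^bsub>skew_ring q\<^esub> (D a) = {v. right_dvd q (D a) v}"
    by (auto simp: cgenideal_def right_dvd_def skew_ring_simps)
  show ?thesis
  proof (rule idealI[OF ring_skew_ring])
    show "subgroup (PIdl\<^bsub>skew_ring q\<^esub> (D a)) (add_monoid (skew_ring q))"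
    proof (rule add.subgroupI)
      show "PIdl\<^bsub>skew_ring q\<^esub> (D a) \<noteq> {}"
        unfolding I right_dvd_def by blast
      fix v assume v: "v \<in> PIdl\<^bsub>skew_ring q\<^esub> (D a)"
      have "\<ominus>\<^bsub>skew_ring q\<^esub> v = - v"
        by (rule minus_equality) (simp_all add: skew_ring_simps)
      moreover have "right_dvd q (D a) (0 - v)"
        using v unfolding I by (intro right_dvd_diff) (auto simp: right_dvd_def intro: exI[of _ 0])
      ultimately show "\<ominus>\<^bsub>skew_ring q\<^esub> v \<in> PIdl\<^bsub>skew_ring q\<^esub> (D a)"
        unfolding I by simp
    qed (auto simp: I right_dvd_add skew_ring_simps)
  next
    fix v x assume "v \<in> PIdl\<^bsub>skew_ring q\<^esub> (D a)"
    then obtain h where h: "v = h \<star> D a" unfolding I right_dvd_def by blast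
    have "x \<star> v = (x \<star> h) \<star> D a" by (simp add: h skew_assoc)
    then show "x \<otimes>\<^bsub>skew_ring q\<^esub> v \<in> PIdl\<^bsub>skew_ring q\<^esub> (D a)"
      unfolding I right_dvd_def by (auto simp: skew_ring_simps)
    have "v \<star> x = (h \<star> x) \<star> D a" by (simp add: h skew_assoc D_central)
    then show "v \<otimes>\<^bsub>skew_ring q\<^esub> x \<in> PIdl\<^bsub>skew_ring q\<^esub> (D a)"
      unfolding I right_dvd_def by (auto simp: skew_ring_simps)
  qed
qed

text \<open>Subtraction in the quotient is reached through addition: \<open>u = (u - v) + v\<close>
  maps to a sum of classes, from which the class of \<open>v\<close> cancels.\<close>

lemma coset_minus_coset:
  fixes u v :: "'k poly" and a :: "'f poly"
  defines "I \<equiv> PIdl\<^bsub>skew_ring q\<^esub> (D a)"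
  shows "(I +>\<^bsub>skew_ring q\<^esub> u) \<ominus>\<^bsub>skew_ring q Quot I\<^esub> (I +>\<^bsub>skew_ring q\<^esub> v) =
    I +>\<^bsub>skew_ring q\<^esub> (u - v)"
proof -
  interpret I: ideal I "skew_ring q" unfolding I_def by (rule ideal_D)
  interpret H: ring_hom_ring "skew_ring q" "skew_ring q Quot I" "(+>\<^bsub>skew_ring q\<^esub>) I"
    by (rule I.rcos_ring_hom_ring)
  have mem: "w \<in> carrier (skew_ring q)" for w :: "'k poly" by (simp add: skew_ring_simps)
  have "u = (u - v) \<oplus>\<^bsub>skew_ring q\<^esub> v" by (simp add: skew_ring_simps)
  then have "I +>\<^bsub>skew_ring q\<^esub> u =
      (I +>\<^bsub>skew_ring q\<^esub> (u - v)) \<oplus>\<^bsub>skew_ring q Quot I\<^esub> (I +>\<^bsub>skew_ring q\<^esub> v)"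
    using H.hom_add[OF mem mem] by metis
  then show ?thesis
    using H.hom_closed[OF mem] by (simp add: a_minus_def H.S.a_assoc H.S.r_neg)
qed

end


section \<open>Endomorphisms of the torsion\<close>

locale drinfeld_torsion = frobenius_tower \<iota> q r
  for \<iota> :: "'f::{field,finite} \<Rightarrow> 'k::{field,finite}" and q r :: nat +
  fixes m :: nat and p :: "'f poly" and \<psi> :: "'f poly set \<Rightarrow> 'e::{field,finite}"
    and b :: "nat \<Rightarrow> 'k alg_closure"
  assumes card_e: "CARD('e) = q ^ m"
    and monic_p: "lead_coeff p = 1" and degree_p: "Polynomial.degree p = m"
    and \<psi>_iso: "\<psi> \<in> ring_iso (class_ring Quot (PIdl\<^bsub>class_ring\<^esub> p)) class_ring"
    and inj_b: "inj_on b {..<r}"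
    and basis_b: "vectorspace.basis class_ring (torsion_space q \<iota> r p \<psi>) (b ` {..<r})"
begin

section \<open>The residue map from A onto F_{q^m}\<close>

definition res :: "'f poly \<Rightarrow> 'e" where
  "res a = \<psi> (PIdl\<^bsub>class_ring\<^esub> p +>\<^bsub>class_ring\<^esub> a)"

text \<open>\<open>res\<close> is the quotient map followed by \<psi>. Surjectivity and its kernel
  let later arguments work with polynomials in place of cosets.\<close>

lemma res_hom: "res \<in> Ring.ring_hom class_ring class_ring"
  and res_surj: "\<exists>a. res a = c"
  and res_eq_iff: "res x = res y \<longleftrightarrow> p dvd x - y"
proof -
  let ?A = "class_ring :: 'f poly ring"
  let ?I = "PIdl\<^bsub>?A\<^esub> p"
  interpret I: ideal ?I ?A
    by (rule cring.cgenideal_ideal) (use class_cring.cring_axioms in auto)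
  have \<psi>: "\<psi> \<in> Ring.ring_hom (?A Quot ?I) class_ring" "bij_betw \<psi> (carrier (?A Quot ?I)) UNIV"
    using \<psi>_iso by (auto simp: ring_iso_def)
  have "(\<psi> \<circ> (+>\<^bsub>?A\<^esub>) ?I) \<in> Ring.ring_hom ?A class_ring"
    by (rule ring_hom_trans[OF I.rcos_ring_hom \<psi>(1)])
  then show "res \<in> Ring.ring_hom class_ring class_ring"
    by (simp add: res_def[abs_def] comp_def)
  have carrier: "carrier (?A Quot ?I) = range (\<lambda>a. ?I +>\<^bsub>?A\<^esub> a)"
    by (simp add: FactRing_def A_RCOSETS_def' UNION_singleton_eq_range)
  show "\<exists>a. res a = c"
  proof -
    have "c \<in> \<psi> ` carrier (?A Quot ?I)" using \<psi>(2) by (simp add: bij_betw_def)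
    then show ?thesis unfolding carrier res_def by blast
  qed
  have "res x = res y \<longleftrightarrow> ?I +>\<^bsub>?A\<^esub> x = ?I +>\<^bsub>?A\<^esub> y"
    unfolding res_def
    by (rule inj_on_eq_iff[OF bij_betw_imp_inj_on[OF \<psi>(2)]]) (simp_all only: carrier rangeI)
  also have "\<dots> \<longleftrightarrow> p dvd x - y"
  proof
    assume "?I +>\<^bsub>?A\<^esub> x = ?I +>\<^bsub>?A\<^esub> y"
    then have "x \<in> {v. p dvd v - y}"
      unfolding class_ring_coset_eq by (metis (mono_tags) diff_self dvd_0_right mem_Collect_eq)
    then show "p dvd x - y" by simp
  next
    assume xy: "p dvd x - y"
    have "p dvd v - x \<longleftrightarrow> p dvd v - y" for v
      using dvd_add_left_iff[OF xy, of "v - x"] by simp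
    then show "?I +>\<^bsub>?A\<^esub> x = ?I +>\<^bsub>?A\<^esub> y"
      unfolding class_ring_coset_eq by (rule Collect_cong)
  qed
  finally show "res x = res y \<longleftrightarrow> p dvd x - y" .
qed

lemma res_add: "res (x + y) = res x + res y"
  and res_mult: "res (x * y) = res x * res y"
  and res_1: "res 1 = 1"
  using res_hom by (auto simp: Ring.ring_hom_def)

lemma res_prod: "res (\<Prod>i\<in>I. f i) = (\<Prod>i\<in>I. res (f i))"
  by (induction I rule: infinite_finite_induct) (simp_all add: res_1 res_mult)

lemma p_nz: "p \<noteq> 0" using monic_p by auto

lemma res_0: "res 0 = 0" using res_add[of 0 0] by (metis add_0 add_cancel_left_left)

lemma res_eq_0_iff: "res x = 0 \<longleftrightarrow> p dvd x"
  using res_eq_iff[of x 0] by (simp add: res_0)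

section \<open>The torsion as a vector space over F_{q^m}\<close>

abbreviation V :: "'k alg_closure set" where "V \<equiv> ker (D p)"

abbreviation sm :: "'e \<Rightarrow> 'k alg_closure \<Rightarrow> 'k alg_closure" where
  "sm \<equiv> torsion_smult q \<iota> r p \<psi>"

text \<open>The representative picked by \<open>SOME\<close> differs from \<open>a\<close> by a
  multiple of \<open>p\<close>, which acts as zero on the torsion.\<close>

lemma torsion_smult_res:
  assumes "\<alpha> \<in> V"
  shows "sm (res a) \<alpha> = act (D a) \<alpha>"
proof -
  define s where "s = (SOME c. res c = res a)"
  have "res s = res a" unfolding s_def by (rule someI_ex) blast
  then obtain k where "s - a = p * k" using res_eq_iff by (auto simp: dvd_def)
  then have "s = k * p + a" by (simp add: algebra_simps)
  then have "act (D s) \<alpha> = act (D a) \<alpha>"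
    using assms by (simp add: D_add act_padd act_D_mult ker_def)
  then show ?thesis by (simp add: torsion_smult_def s_def flip: res_def)
qed

lemma torsion_smult_in_V: "\<alpha> \<in> V \<Longrightarrow> sm c \<alpha> \<in> V"
  using res_surj[of c] torsion_smult_res act_in_ker_D by metis

text \<open>Scalars are lifted to A along \<open>res\<close>, where the law is additivity of \<phi>;
  the law for products is obtained in the same way.\<close>

lemma torsion_smult_add_left: "\<alpha> \<in> V \<Longrightarrow> sm (c + d) \<alpha> = sm c \<alpha> + sm d \<alpha>"
  using res_surj[of c] res_surj[of d] by (auto simp: torsion_smult_res D_add act_padd simp flip: res_add)

lemma torsion_smult_mult: "\<alpha> \<in> V \<Longrightarrow> sm (c * d) \<alpha> = sm c (sm d \<alpha>)"
  using res_surj[of c] res_surj[of d]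
  by (auto simp: torsion_smult_res act_D_mult act_in_ker_D simp flip: res_mult)

lemma torsion_smult_add_right:
  "\<alpha> \<in> V \<Longrightarrow> \<beta> \<in> V \<Longrightarrow> sm c (\<alpha> + \<beta>) = sm c \<alpha> + sm c \<beta>"
  using res_surj[of c] by (auto simp: torsion_smult_def act_add)

lemma torsion_smult_1: "\<alpha> \<in> V \<Longrightarrow> sm 1 \<alpha> = \<alpha>"
  using torsion_smult_res[of \<alpha> 1] by (simp add: res_1)

lemma act_torsion_smult: "\<alpha> \<in> V \<Longrightarrow> act f (sm c \<alpha>) = sm c (act f \<alpha>)"
  using res_surj[of c] by (auto simp: torsion_smult_def act_D_commute)

lemma V_add: "\<alpha> \<in> V \<Longrightarrow> \<beta> \<in> V \<Longrightarrow> \<alpha> + \<beta> \<in> V"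
  by (simp add: ker_def act_add)

abbreviation S where "S \<equiv> torsion_space q \<iota> r p \<psi>"

lemma S_simps [simp]:
  "carrier S = V" "add S = (+)" "zero S = 0" "module.smult S = sm"
  by (simp_all add: torsion_space_def torsion_eq_ker)

lemma vectorspace_S: "vectorspace class_ring S"
proof -
  have "abelian_group S"
  proof (rule abelian_groupI)
    fix x assume "x \<in> carrier S"
    then show "\<exists>y\<in>carrier S. y \<oplus>\<^bsub>S\<^esub> x = \<zero>\<^bsub>S\<^esub>"
      by (intro bexI[of _ "- x"]) (auto simp: ker_def act_uminus)
  qed (auto simp: V_add add_ac)
  then have "module class_ring S"
    by (intro module.intro module_axioms.intro)
       (use class_cring.cring_axioms in \<open>auto simp: torsion_smult_in_V torsion_smult_add_left
          torsion_smult_mult torsion_smult_add_right torsion_smult_1\<close>)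
  then show ?thesis
    by (intro vectorspace.intro) (use class_field.field_axioms in auto)
qed

sublocale S: vectorspace class_ring S
  by (rule vectorspace_S)

lemma b_in_V: "k < r \<Longrightarrow> b k \<in> V"
  using basis_b S.basis_def by auto

lemma torsion_smult_0: "\<alpha> \<in> V \<Longrightarrow> sm 0 \<alpha> = 0"
  using torsion_smult_res[of \<alpha> 0] by (simp add: res_0)

lemma torsion_smult_diff_left: "\<alpha> \<in> V \<Longrightarrow> sm (c - d) \<alpha> = sm c \<alpha> - sm d \<alpha>"
  using torsion_smult_add_left[of \<alpha> "c - d" d] by simp

lemma V_sum: "(\<And>i. i \<in> I \<Longrightarrow> f i \<in> V) \<Longrightarrow> (\<Sum>i\<in>I. f i) \<in> V"
  by (induction I rule: infinite_finite_induct) (auto simp: V_add)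

lemma torsion_smult_sum_left: "\<alpha> \<in> V \<Longrightarrow> sm (\<Sum>i\<in>I. f i) \<alpha> = (\<Sum>i\<in>I. sm (f i) \<alpha>)"
  by (induction I rule: infinite_finite_induct)
     (simp_all add: torsion_smult_0 torsion_smult_add_left)

lemma torsion_smult_0_right: "sm c 0 = 0"
  by (simp add: torsion_smult_def)

lemma torsion_smult_sum_right:
  "(\<And>i. i \<in> I \<Longrightarrow> f i \<in> V) \<Longrightarrow> sm c (\<Sum>i\<in>I. f i) = (\<Sum>i\<in>I. sm c (f i))"
  by (induction I rule: infinite_finite_induct)
     (simp_all add: torsion_smult_0_right torsion_smult_add_right V_sum)

section \<open>Coordinates with respect to the given basis\<close>

lemma finsum_S: "finite I \<Longrightarrow> (\<And>i. i \<in> I \<Longrightarrow> f i \<in> V) \<Longrightarrow> finsum S f I = (\<Sum>i\<in>I. f i)"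
  by (induction I rule: finite_induct) (auto simp: S.finsum_insert Pi_def)

text \<open>The coordinate isomorphism. Its argument is a function on all naturals, read below
  \<open>r\<close>, so that matrix columns and entries of vectors fit alike.\<close>

definition L :: "(nat \<Rightarrow> 'e) \<Rightarrow> 'k alg_closure" where
  "L c = (\<Sum>k<r. sm (c k) (b k))"

lemma L_in_V: "L c \<in> V"
  unfolding L_def by (intro V_sum torsion_smult_in_V b_in_V) auto

lemma lincomb_S: "S.lincomb a (b ` {..<r}) = L (\<lambda>k. a (b k))"
proof -
  have "S.lincomb a (b ` {..<r}) = (\<Sum>v\<in>b ` {..<r}. sm (a v) v)"
    unfolding S.lincomb_def by (subst finsum_S) (auto simp: torsion_smult_in_V b_in_V)
  then show ?thesis by (simp add: L_def sum.reindex[OF inj_b])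
qed

lemma basis_unique_lincomb:
  assumes "v \<in> V"
  shows "\<exists>!a. a \<in> b ` {..<r} \<rightarrow>\<^sub>E UNIV \<and> L (\<lambda>k. a (b k)) = v"
  using S.basis_criterion[of "b ` {..<r}"] basis_b assms b_in_V
  by (auto simp: lincomb_S image_subset_iff)

lemma L_surj:
  assumes "v \<in> V" obtains c where "v = L c"
  using basis_unique_lincomb[OF assms] by auto

lemma L_inj:
  assumes "L c = L d" "k < r" shows "c k = d k"
proof -
  \<comment> \<open>Coordinates indexed by \<open>k\<close> are moved to the basis vectors and made
    extensional, the form in which uniqueness is available.\<close>
  define f where "f c = (\<lambda>x\<in>b ` {..<r}. c (the_inv_into {..<r} b x))" for c :: "nat \<Rightarrow> 'e"
  have f: "f c (b k) = c k" if "k < r" for c k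
    using that by (simp add: f_def the_inv_into_f_f[OF inj_b])
  then have "L (\<lambda>k. f c (b k)) = L c" for c by (simp add: L_def)
  moreover have "f c \<in> b ` {..<r} \<rightarrow>\<^sub>E UNIV" for c by (simp add: f_def)
  ultimately have "f c = f d" using basis_unique_lincomb[OF L_in_V[of c]] assms(1) by metis
  then show ?thesis using f assms(2) by metis
qed

lemma card_V: "card V = q ^ (m * r)"
  using S.card_carrier_eq_power_basis[OF _ basis_b] card_image[OF inj_b]
  by (simp add: card_e power_mult)

lemma degree_D_p: "Polynomial.degree (D p) = m * r"
  by (simp add: degree_D degree_p)

lemma finite_V: "finite V"
  using finite_ker p_nz by simp

section \<open>The matrix of the induced endomorphism\<close>

abbreviation coset :: "'k poly \<Rightarrow> 'k poly set" where
  "coset u \<equiv> PIdl\<^bsub>skew_ring q\<^esub> (D p) +>\<^bsub>skew_ring q\<^esub> u"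

abbreviation tm :: "'k poly set \<Rightarrow> 'e mat" where
  "tm \<equiv> torsion_matrix q \<iota> r p \<psi> b"

lemma act_coset:
  assumes "v \<in> coset u" "x \<in> V" shows "act v x = act u x"
proof -
  obtain h where "v - u = h \<star> D p" using assms(1) by (auto simp: skew_coset_eq right_dvd_def)
  then have "act (v - u) x = 0" using assms(2) by (simp add: act_mult ker_def)
  then show ?thesis by (simp add: act_pdiff)
qed

lemma torsion_matrix_ex1:
  "\<exists>!M. M \<in> carrier_mat r r \<and> (\<forall>j<r. act u (b j) = L (\<lambda>k. M $$ (k, j)))"
proof -
  have "\<forall>j. \<exists>c. j < r \<longrightarrow> act u (b j) = L c"
    using L_surj act_in_ker_D b_in_V by metis
  then obtain c where c: "\<And>j. j < r \<Longrightarrow> act u (b j) = L (c j)" by metis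
  show ?thesis
  proof (rule ex1I[of _ "mat r r (\<lambda>(k, j). c j k)"])
    show "mat r r (\<lambda>(k, j). c j k) \<in> carrier_mat r r \<and>
        (\<forall>j<r. act u (b j) = L (\<lambda>k. mat r r (\<lambda>(k, j). c j k) $$ (k, j)))"
      using c by (simp add: L_def)
  next
    fix M assume M: "M \<in> carrier_mat r r \<and> (\<forall>j<r. act u (b j) = L (\<lambda>k. M $$ (k, j)))"
    then have "L (c j) = L (\<lambda>k. M $$ (k, j))" if "j < r" for j using c that by metis
    then have "c j k = M $$ (k, j)" if "j < r" "k < r" for j k using L_inj that by blast
    with M show "M = mat r r (\<lambda>(k, j). c j k)" by (intro eq_matI) auto
  qed
qed

text \<open>All representatives of a class agree on the torsion, so the condition over the whole
  coset reduces to one for \<open>u\<close>.\<close>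

lemma torsion_matrix_altdef:
  "tm (coset u) = (THE M. M \<in> carrier_mat r r \<and> (\<forall>j<r. act u (b j) = L (\<lambda>k. M $$ (k, j))))"
proof -
  have u: "u \<in> coset u"
    unfolding skew_coset_eq right_dvd_def by (auto intro: exI[of _ 0])
  have "(\<forall>v\<in>coset u. \<forall>j<r. act v (b j) = Z j) \<longleftrightarrow> (\<forall>j<r. act u (b j) = Z j)" for Z
    using act_coset b_in_V u by metis
  then show ?thesis by (simp add: torsion_matrix_def L_def)
qed

lemma torsion_matrix_carrier: "tm (coset u) \<in> carrier_mat r r"
  and torsion_matrix_act: "j < r \<Longrightarrow> act u (b j) = L (\<lambda>k. tm (coset u) $$ (k, j))"
  using theI'[OF torsion_matrix_ex1[of u]] unfolding torsion_matrix_altdef by blast+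

lemma torsion_matrix_eqI:
  assumes "M \<in> carrier_mat r r" "\<And>j. j < r \<Longrightarrow> act u (b j) = L (\<lambda>k. M $$ (k, j))"
  shows "tm (coset u) = M"
  unfolding torsion_matrix_altdef
  by (rule the1_equality[OF torsion_matrix_ex1]) (use assms in blast)

lemma L_diff: "L (\<lambda>k. c k - d k) = L c - L d"
  by (simp add: L_def torsion_smult_diff_left b_in_V sum_subtractf)

lemma torsion_matrix_diff: "tm (coset (u - v)) = tm (coset u) - tm (coset v)"
proof (rule torsion_matrix_eqI)
  show "tm (coset u) - tm (coset v) \<in> carrier_mat r r"
    using torsion_matrix_carrier by (intro minus_carrier_mat)
  fix j assume j: "j < r"
  have "L (\<lambda>k. (tm (coset u) - tm (coset v)) $$ (k, j)) =
      L (\<lambda>k. tm (coset u) $$ (k, j) - tm (coset v) $$ (k, j))"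
    unfolding L_def by (rule sum.cong)
      (use j torsion_matrix_carrier[of u] torsion_matrix_carrier[of v] in auto)
  then show "act (u - v) (b j) = L (\<lambda>k. (tm (coset u) - tm (coset v)) $$ (k, j))"
    using j by (simp add: L_diff act_pdiff torsion_matrix_act)
qed

text \<open>Since \<open>u\<close> commutes with scalars, its action in coordinates is
  multiplication by its matrix.\<close>

lemma act_L: "act u (L (vec_index v)) = L (vec_index (tm (coset u) *\<^sub>v v))" if v: "v \<in> carrier_vec r"
proof -
  let ?M = "tm (coset u)"
  have "act u (L (vec_index v)) = (\<Sum>j<r. sm (v $ j) (\<Sum>k<r. sm (?M $$ (k, j)) (b k)))"
    by (simp add: L_def act_sum act_torsion_smult b_in_V torsion_matrix_act)
  also have "\<dots> = (\<Sum>j<r. \<Sum>k<r. sm (v $ j * ?M $$ (k, j)) (b k))"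
    by (intro sum.cong refl, subst torsion_smult_sum_right)
       (auto simp: torsion_smult_in_V b_in_V torsion_smult_mult)
  also have "\<dots> = (\<Sum>k<r. \<Sum>j<r. sm (v $ j * ?M $$ (k, j)) (b k))"
    by (rule sum.swap)
  also have "\<dots> = (\<Sum>k<r. sm (\<Sum>j<r. v $ j * ?M $$ (k, j)) (b k))"
    by (simp add: torsion_smult_sum_left b_in_V)
  also have "\<dots> = L (vec_index (?M *\<^sub>v v))"
    unfolding L_def
  proof (rule sum.cong[OF refl])
    fix k assume "k \<in> {..<r}"
    then have "(?M *\<^sub>v v) $ k = (\<Sum>j<r. v $ j * ?M $$ (k, j))"
      using torsion_matrix_carrier[of u] v
      by (auto simp: scalar_prod_def mult.commute atLeast0LessThan intro!: sum.cong)
    then show "sm (\<Sum>j<r. v $ j * ?M $$ (k, j)) (b k) = sm ((?M *\<^sub>v v) $ k) (b k)" by simp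
  qed
  finally show ?thesis .
qed

lemma V_eq_image: "V = (\<lambda>v. L (vec_index v)) ` carrier_vec r"
proof -
  have "L c = L (vec_index (vec r c))" for c by (simp add: L_def)
  then show ?thesis using L_surj L_in_V by (auto simp: image_iff) (metis vec_carrier)
qed

text \<open>Coordinates match the image with the column space, counted over a field of
  \<open>q ^ m\<close> elements; hence the \<open>m\<close> in the exponent.\<close>

lemma card_act_image: "card (act u ` V) = q ^ (m * vec_space.rank r (tm (coset u)))"
proof -
  let ?M = "tm (coset u)"
  have "act u ` V = (\<lambda>v. L (vec_index v)) ` (\<lambda>v. ?M *\<^sub>v v) ` carrier_vec r"
    unfolding V_eq_image image_image by (intro image_cong refl act_L)
  moreover have "inj_on (\<lambda>v. L (vec_index v)) ((\<lambda>v. ?M *\<^sub>v v) ` carrier_vec r)"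
  proof (rule inj_onI)
    fix x y assume "x \<in> (\<lambda>v. ?M *\<^sub>v v) ` carrier_vec r" "y \<in> (\<lambda>v. ?M *\<^sub>v v) ` carrier_vec r"
      and eq: "L (vec_index x) = L (vec_index y)"
    then have "dim_vec x = r" "dim_vec y = r" using torsion_matrix_carrier[of u] by auto
    then show "x = y" using L_inj[OF eq] by (intro eq_vecI) auto
  qed
  ultimately have "card (act u ` V) = card ((\<lambda>v. ?M *\<^sub>v v) ` carrier_vec r)"
    by (simp add: card_image)
  also have "\<dots> = q ^ (m * vec_space.rank r ?M)"
    by (simp add: card_range_mult_mat_vec[OF torsion_matrix_carrier] card_e power_mult)
  finally show ?thesis .
qed

lemma card_V_Int_ker:
  "card (ker u \<inter> V) = q ^ (m * (r - vec_space.rank r (tm (coset u))))"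
  and rank_torsion_matrix_le: "vec_space.rank r (tm (coset u)) \<le> r"
proof -
  show le: "vec_space.rank r (tm (coset u)) \<le> r"
    using vec_space.rank_le_nc[OF torsion_matrix_carrier] .
  have "card V = card (act u ` V) * card {x \<in> V. act u x = 0}"
    by (rule card_eq_card_image_times_card_kernel) (auto simp: finite_V ker_diff act_diff)
  also have "{x \<in> V. act u x = 0} = ker u \<inter> V" by (auto simp: ker_def)
  \<comment> \<open>The rank bound allows \<open>r\<close> to be split as rank plus corank without
    truncation, leaving a common power to cancel.\<close>
  finally have "q ^ (m * vec_space.rank r (tm (coset u))) * card (ker u \<inter> V) =
      q ^ (m * vec_space.rank r (tm (coset u))) * q ^ (m * (r - vec_space.rank r (tm (coset u))))"
    using le by (simp add: card_V card_act_image flip: power_add distrib_left)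
  then show "card (ker u \<inter> V) = q ^ (m * (r - vec_space.rank r (tm (coset u))))"
    using q_pos by (metis mult_left_cancel not_gr_zero power_eq_0_iff)
qed

text \<open>Equal matrices make \<open>u - v\<close> vanish on the torsion, which holds as many
  zeros as the degree of \<open>D p\<close> permits; so \<open>D p\<close> divides
  \<open>u - v\<close>.\<close>

lemma torsion_matrix_inj:
  assumes "tm (coset u) = tm (coset v)" shows "coset u = coset v"
proof -
  have b: "act u (b j) = act v (b j)" if "j < r" for j
    using assms torsion_matrix_act[OF that] by metis
  have "act u x = act v x" if "x \<in> V" for x
  proof -
    from L_surj[OF that] obtain c where "x = L c" .
    then show ?thesis by (simp add: L_def act_sum act_torsion_smult b_in_V b)
  qed
  then have "V \<subseteq> ker (u - v)" by (auto simp: ker_def act_pdiff)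
  then have "right_dvd q (D p) (u - v)"
    by (intro ker_subset_imp_right_dvd) (auto simp: p_nz card_V degree_D_p)
  then show ?thesis by (simp add: skew_coset_eq_iff)
qed

lemma m_pos: "0 < m"
proof (rule ccontr)
  assume "\<not> 0 < m"
  then have "CARD('e) = 1" using card_e by simp
  then have "(0 :: 'e) = 1" by (metis UNIV_I card_1_singletonE singletonD)
  then show False by simp
qed

lemma bij_betw_coset:
  "bij_betw coset {f. Polynomial.degree f < m * r} (carrier (skew_ring q Quot (PIdl\<^bsub>skew_ring q\<^esub> (D p))))"
  unfolding carrier_skew_Quot
proof (rule bij_betw_imageI)
  show "inj_on coset {f. Polynomial.degree f < m * r}"
  proof (rule inj_onI)
    fix u v assume uv: "u \<in> {f. Polynomial.degree f < m * r}" "v \<in> {f. Polynomial.degree f < m * r}"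
      and "coset u = coset v"
    then have "right_dvd q (D p) (u - v)" by (simp add: skew_coset_eq_iff)
    moreover have "Polynomial.degree (u - v) < Polynomial.degree (D p)"
      using uv by (simp add: degree_D_p degree_diff_less)
    ultimately show "u = v" using right_dvd_small_imp_0 by fastforce
  qed
  have "\<exists>s. Polynomial.degree s < m * r \<and> coset u = coset s" for u
  proof -
    obtain h s where hs: "u = h \<star> D p + s" "s = 0 \<or> Polynomial.degree s < Polynomial.degree (D p)"
      using right_division[of "D p" u] p_nz by auto
    then have "right_dvd q (D p) (u - s)" by (auto simp: right_dvd_def)
    \<comment> \<open>A zero remainder has degree 0, so this needs \<open>m * r\<close>
      positive.\<close>
    moreover have "Polynomial.degree s < m * r" using hs(2) m_pos by (auto simp: degree_D_p)
    ultimately show ?thesis by (auto simp: skew_coset_eq_iff)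
  qed
  then show "coset ` {f. Polynomial.degree f < m * r} = range coset" by blast
qed

lemma card_quotient:
  "card (carrier (skew_ring q Quot (PIdl\<^bsub>skew_ring q\<^esub> (D p)))) = q ^ (m * r * r)"
  and finite_quotient: "finite (carrier (skew_ring q Quot (PIdl\<^bsub>skew_ring q\<^esub> (D p))))"
  using bij_betw_same_card[OF bij_betw_coset] bij_betw_finite[OF bij_betw_coset]
    card_degree_less[of "m * r", where 'a = 'k] m_pos
  by (simp_all add: card_k mult_ac flip: power_mult)

text \<open>Injectivity suffices: the quotient has \<open>(q ^ r) ^ (m * r)\<close> classes, and
  there are \<open>(q ^ m) ^ (r * r)\<close> matrices.\<close>

lemma bij_betw_torsion_matrix:
  "bij_betw tm (carrier (skew_ring q Quot (PIdl\<^bsub>skew_ring q\<^esub> (D p)))) (carrier_mat r r)"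
proof (rule bij_betw_imageI)
  let ?C = "carrier (skew_ring q Quot (PIdl\<^bsub>skew_ring q\<^esub> (D p)))"
  show inj: "inj_on tm ?C"
    unfolding carrier_skew_Quot by (rule inj_onI) (use torsion_matrix_inj in blast)
  show "tm ` ?C = carrier_mat r r"
  proof (rule card_subset_eq)
    show "tm ` ?C \<subseteq> carrier_mat r r"
      unfolding carrier_skew_Quot using torsion_matrix_carrier by blast
    show "card (tm ` ?C) = card (carrier_mat r r :: 'e mat set)"
      by (simp add: card_image[OF inj] card_quotient card_carrier_mat card_e mult_ac flip: power_mult)
  qed (rule finite_carrier_mat)
qed

end


section \<open>The Chinese remainder map and the isometry\<close>

locale drinfeld_code = frobenius_tower \<iota> q r
  for \<iota> :: "'f::{field,finite} \<Rightarrow> 'k::{field,finite}" and q r :: nat +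
  fixes m l :: nat and \<qq> :: "nat \<Rightarrow> 'f poly" and \<psi> :: "nat \<Rightarrow> 'f poly set \<Rightarrow> 'e::{field,finite}"
    and b :: "nat \<Rightarrow> nat \<Rightarrow> 'k alg_closure"
  assumes torsion: "i < l \<Longrightarrow> drinfeld_torsion \<iota> q r m (\<qq> i) (\<psi> i) (b i)"
    and inj_\<qq>: "inj_on \<qq> {..<l}" and l_pos: "0 < l"
begin

abbreviation Q :: "nat \<Rightarrow> 'k poly" where "Q \<equiv> \<lambda>i. D (\<qq> i)"

abbreviation P :: "'f poly" where "P \<equiv> \<Prod>i<l. \<qq> i"

abbreviation \<Theta> :: "(nat \<Rightarrow> 'k poly set) \<Rightarrow> nat \<Rightarrow> 'e mat" where
  "\<Theta> \<equiv> Theta q \<iota> r l \<qq> \<psi> b"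

abbreviation rk :: "nat \<Rightarrow> 'k poly \<Rightarrow> nat" where
  "rk i u \<equiv> vec_space.rank r (torsion_matrix q \<iota> r (\<qq> i) (\<psi> i) (b i)
     (PIdl\<^bsub>skew_ring q\<^esub> (Q i) +>\<^bsub>skew_ring q\<^esub> u))"

lemma \<qq>_nz: "i < l \<Longrightarrow> \<qq> i \<noteq> 0"
  using drinfeld_torsion.p_nz torsion by blast

lemma degree_\<qq>: "i < l \<Longrightarrow> Polynomial.degree (\<qq> i) = m"
  using drinfeld_torsion.degree_p torsion by blast

lemma m_pos: "0 < m"
  using drinfeld_torsion.m_pos[OF torsion[OF l_pos]] .

lemma P_nz: "P \<noteq> 0"
  by (simp add: \<qq>_nz)

lemma degree_P: "Polynomial.degree (D P) = m * l * r"
proof -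
  have "Polynomial.degree P = (\<Sum>i<l. Polynomial.degree (\<qq> i))"
    by (rule degree_prod_sum_eq) (use \<qq>_nz in auto)
  then show ?thesis by (simp add: degree_D degree_\<qq> mult_ac)
qed

text \<open>Equal degrees make the cofactor constant and monicity makes it 1, against
  distinctness.\<close>

lemma not_dvd:
  assumes "i < l" "j < l" "i \<noteq> j" shows "\<not> \<qq> i dvd \<qq> j"
proof
  assume "\<qq> i dvd \<qq> j"
  then obtain h where h: "\<qq> j = \<qq> i * h" by (auto simp: dvd_def)
  have lc: "lead_coeff (\<qq> k) = 1" if "k < l" for k
    using drinfeld_torsion.monic_p[OF torsion[OF that]] .
  have "h \<noteq> 0" using h \<qq>_nz[OF assms(2)] by auto
  then have "Polynomial.degree h = 0"
    using h degree_\<qq>[OF assms(1)] degree_\<qq>[OF assms(2)] \<qq>_nz[OF assms(1)]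
    by (simp add: degree_mult_eq)
  moreover have "lead_coeff h = 1"
    using h lc[OF assms(1)] lc[OF assms(2)] lead_coeff_mult[of "\<qq> i" h] by simp
  ultimately have "h = 1" by (metis degree_eq_zeroE lead_coeff_pCons(2) one_pCons)
  then have "\<qq> i = \<qq> j" using h by simp
  then show False using inj_\<qq> assms by (auto dest: inj_onD)
qed

text \<open>Modulo \<open>\<qq> n\<close> the product has nonzero residue, since \<open>'e\<close>
  has no zero divisors; \<open>s\<close> lifts the inverse of that residue.\<close>

lemma bezout:
  assumes "n < l" obtains s t where "s * (\<Prod>i<n. \<qq> i) + t * \<qq> n = 1"
proof -
  interpret drinfeld_torsion \<iota> q r m "\<qq> n" "\<psi> n" "b n" by (rule torsion[OF assms])
  let ?a = "\<Prod>i<n. \<qq> i"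
  have "res ?a = (\<Prod>i<n. res (\<qq> i))" by (rule res_prod)
  moreover have "res (\<qq> i) \<noteq> 0" if "i < n" for i
    using not_dvd[of n i] that assms by (simp add: res_eq_0_iff)
  ultimately have "res ?a \<noteq> 0" by simp
  obtain s where "res s = inverse (res ?a)" using res_surj by blast
  then have "res (s * ?a) = res 1" using \<open>res ?a \<noteq> 0\<close> by (simp add: res_mult res_1)
  then obtain t where "s * ?a - 1 = \<qq> n * t" using res_eq_iff by (auto simp: dvd_def)
  then have "s * ?a + (- t) * \<qq> n = 1" by (simp add: algebra_simps)
  then show ?thesis by (rule that)
qed

text \<open>One coprime factor is split off at a time. The choice \<open>Y = 0\<close>, whose kernel
  is the whole closure, gives the size of the full torsion.\<close>

lemma card_ker_Int_ker_prod:
  assumes "n \<le> l"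
  shows "card (ker Y \<inter> ker (D (\<Prod>i<n. \<qq> i))) = (\<Prod>i<n. card (ker Y \<inter> ker (Q i)))"
  using assms
proof (induction n)
  case 0
  have "ker Y \<inter> ker (D 1) = {0}" by (auto simp: ker_def)
  then show ?case by simp
next
  case (Suc n)
  obtain s t where "s * (\<Prod>i<n. \<qq> i) + t * \<qq> n = 1"
    using bezout Suc.prems by (metis Suc_le_eq)
  moreover have "(\<Prod>i<n. \<qq> i) * \<qq> n \<noteq> 0" using Suc.prems \<qq>_nz by auto
  ultimately show ?case using Suc card_ker_Int_ker_D_mult by simp
qed

lemma card_ker_Int_ker_P:
  "card (ker Y \<inter> ker (D P)) = q ^ (\<Sum>i<l. m * (r - rk i Y))"
proof -
  have "card (ker Y \<inter> ker (Q i)) = q ^ (m * (r - rk i Y))" if "i < l" for i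
    using drinfeld_torsion.card_V_Int_ker[OF torsion[OF that]] .
  then show ?thesis by (simp add: card_ker_Int_ker_prod power_sum)
qed

lemma card_ker_P: "card (ker (D P)) = q ^ (m * l * r)"
proof -
  have "ker 0 \<inter> ker f = ker f" for f by (auto simp: ker_def)
  moreover have "card (ker (Q i)) = q ^ (m * r)" if "i < l" for i
    using drinfeld_torsion.card_V[OF torsion[OF that]] .
  ultimately have "card (ker (D P)) = (\<Prod>i<l. q ^ (m * r))"
    using card_ker_Int_ker_prod[of l 0] by simp
  then show ?thesis by (simp add: mult_ac flip: power_mult)
qed

text \<open>A nonzero difference would vanish on every torsion block, hence at
  \<open>q ^ (m * l * r)\<close> points, more than its degree allows.\<close>

lemma CRT_inj:
  assumes "CRT q l Q u = CRT q l Q v" "Polynomial.degree u < m * l * r" "Polynomial.degree v < m * l * r"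
  shows "u = v"
proof (rule ccontr)
  assume "u \<noteq> v"
  then have nz: "u - v \<noteq> 0" by simp
  have "ker (u - v) \<inter> ker (Q i) = ker (Q i)" if "i < l" for i
  proof -
    have "right_dvd q (Q i) (u - v)"
      using fun_cong[OF assms(1), of i] that by (simp add: CRT_def skew_coset_eq_iff)
    then show ?thesis using ker_right_dvd by blast
  qed
  then have "card (ker (u - v) \<inter> ker (D P)) = (\<Prod>i<l. card (ker (Q i)))"
    by (simp add: card_ker_Int_ker_prod)
  also have "\<dots> = q ^ (m * l * r)"
    using drinfeld_torsion.card_V[OF torsion] by (simp add: mult_ac flip: power_mult)
  finally have "q ^ (m * l * r) \<le> card (ker (u - v))"
    using card_mono[OF finite_ker[OF nz], of "ker (u - v) \<inter> ker (D P)"] by simp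
  also have "\<dots> \<le> q ^ Polynomial.degree (u - v)" by (rule card_ker_le[OF nz])
  also have "\<dots> < q ^ (m * l * r)"
    using assms(2,3) q_ge_2 by (intro power_strict_increasing degree_diff_less) auto
  finally show False by simp
qed

lemma R_Gamma_eq: "R_Gamma q l Q = (\<Pi>\<^sub>E i\<in>{..<l}. range (\<lambda>u. PIdl\<^bsub>skew_ring q\<^esub> (Q i) +>\<^bsub>skew_ring q\<^esub> u))"
  by (simp add: R_Gamma_def res_ring_def carrier_skew_Quot)

lemma finite_R_Gamma: "finite (R_Gamma q l Q)"
  and card_R_Gamma: "card (R_Gamma q l Q) = q ^ (m * r * r * l)"
  using drinfeld_torsion.finite_quotient[OF torsion] drinfeld_torsion.card_quotient[OF torsion]
  by (auto simp: R_Gamma_def res_ring_def card_PiE power_mult intro!: finite_PiE)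

text \<open>Surjectivity is a count: \<open>(q ^ r) ^ (m * l * r)\<close> polynomials against
  \<open>l\<close> factors of size \<open>q ^ (m * r * r)\<close>.\<close>

lemma bij_betw_CRT: "bij_betw (CRT q l Q) {u. Polynomial.degree u < m * l * r} (R_Gamma q l Q)"
proof (rule bij_betw_imageI)
  show inj: "inj_on (CRT q l Q) {u. Polynomial.degree u < m * l * r}"
    by (rule inj_onI) (simp add: CRT_inj)
  have "0 < m * l * r" using m_pos l_pos by simp
  then have "card (CRT q l Q ` {u. Polynomial.degree u < m * l * r}) = CARD('k) ^ (m * l * r)"
    unfolding card_image[OF inj] by (rule card_degree_less)
  then have "card (CRT q l Q ` {u. Polynomial.degree u < m * l * r}) = card (R_Gamma q l Q)"
    by (simp add: card_R_Gamma card_k mult_ac flip: power_mult)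
  moreover have "CRT q l Q ` {u. Polynomial.degree u < m * l * r} \<subseteq> R_Gamma q l Q"
    by (auto simp: R_Gamma_eq CRT_def)
  ultimately show "CRT q l Q ` {u. Polynomial.degree u < m * l * r} = R_Gamma q l Q"
    by (intro card_subset_eq finite_R_Gamma)
qed

lemma CRT_lift_props:
  assumes "y \<in> R_Gamma q l Q"
  shows "Polynomial.degree (CRT_lift q l Q y) < m * l * r" "CRT q l Q (CRT_lift q l Q y) = y"
proof -
  have "y \<in> CRT q l Q ` {u. Polynomial.degree u < m * l * r}"
    using assms by (simp only: bij_betw_imp_surj_on[OF bij_betw_CRT])
  then obtain Z where "Polynomial.degree Z < m * l * r" "CRT q l Q Z = y" by blast
  then have "\<exists>!Y. Polynomial.degree Y < m * l * r \<and> CRT q l Q Y = y"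
    using CRT_inj by (metis (no_types))
  from theI'[OF this] show "Polynomial.degree (CRT_lift q l Q y) < m * l * r"
    "CRT q l Q (CRT_lift q l Q y) = y"
    unfolding CRT_lift_def skew_Prod_D degree_P by blast+
qed

text \<open>The zero tuple needs no separate case, since the gcrd facts ask for a nonzero first
  argument, here \<Pi>.\<close>

lemma wt_ps_eq:
  assumes "y \<in> R_Gamma q l Q"
  shows "wt_ps q l Q y = m * wt_SR r l (\<Theta> y)"
proof -
  define Y where "Y = CRT_lift q l Q y"
  have y: "y i = PIdl\<^bsub>skew_ring q\<^esub> (Q i) +>\<^bsub>skew_ring q\<^esub> Y" if "i < l" for i
    using fun_cong[OF CRT_lift_props(2)[OF assms], of i] that by (simp add: CRT_def Y_def)
  have nz: "D P \<noteq> 0" using P_nz by simp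
  have le: "rk i Y \<le> r" if "i < l" for i
    using drinfeld_torsion.rank_torsion_matrix_le[OF torsion[OF that]] .
  \<comment> \<open>Two counts of the zeros of \<Pi> killed by \<open>Y\<close>: through the gcrd
    and block by block.\<close>
  have "q ^ Polynomial.degree (gcrd q (D P) Y) = q ^ (\<Sum>i<l. m * (r - rk i Y))"
    using card_ker_gcrd[OF nz, of Y] card_ker_P card_ker_Int_ker_P[of Y] degree_P
    by (simp add: Int_commute)
  then have "Polynomial.degree (gcrd q (D P) Y) = (\<Sum>i<l. m * (r - rk i Y))"
    using q_ge_2 by (simp add: power_inject_exp)
  \<comment> \<open>Stated as a sum, so that the natural subtraction in \<open>wt_ps\<close> can be
    resolved.\<close>
  moreover have "(\<Sum>i<l. m * (r - rk i Y)) + m * (\<Sum>i<l. rk i Y) = m * l * r"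
  proof -
    have "(\<Sum>i<l. m * (r - rk i Y)) + m * (\<Sum>i<l. rk i Y) = (\<Sum>i<l. m * (r - rk i Y) + m * rk i Y)"
      by (simp add: sum.distrib sum_distrib_left)
    also have "\<dots> = (\<Sum>i<l. m * r)"
      by (rule sum.cong) (use le in \<open>auto simp flip: distrib_left\<close>)
    finally show ?thesis by (simp add: mult_ac)
  qed
  moreover have "wt_SR r l (\<Theta> y) = (\<Sum>i<l. rk i Y)"
    by (simp add: wt_SR_def Theta_def y)
  ultimately show ?thesis
    by (simp add: wt_ps_def skew_Prod_D degree_P flip: Y_def)
qed

lemma bij_betw_Theta: "bij_betw \<Theta> (R_Gamma q l Q) (mat_tuples r l)"
proof -
  define f where "f i = torsion_matrix q \<iota> r (\<qq> i) (\<psi> i) (b i)" for i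
  have f: "bij_betw (f i) (carrier (res_ring q Q i)) (carrier_mat r r)" if "i < l" for i
    using drinfeld_torsion.bij_betw_torsion_matrix[OF torsion[OF that]]
    by (simp add: f_def res_ring_def)
  let ?g = "\<lambda>M. \<lambda>i\<in>{..<l}. inv_into (carrier (res_ring q Q i)) (f i) (M i)"
  have "bij_betw (\<lambda>y. \<lambda>i\<in>{..<l}. f i (y i)) (\<Pi>\<^sub>E i\<in>{..<l}. carrier (res_ring q Q i))
      (\<Pi>\<^sub>E i\<in>{..<l}. carrier_mat r r)"
  proof (rule bij_betwI[of _ _ _ ?g])
    show "(\<lambda>y. \<lambda>i\<in>{..<l}. f i (y i)) \<in>
        (\<Pi>\<^sub>E i\<in>{..<l}. carrier (res_ring q Q i)) \<rightarrow> (\<Pi>\<^sub>E i\<in>{..<l}. carrier_mat r r)"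
      using bij_betwE[OF f] by (intro funcsetI restrict_PiE_iff[THEN iffD2]) (auto simp: PiE_iff)
    show "?g \<in> (\<Pi>\<^sub>E i\<in>{..<l}. carrier_mat r r) \<rightarrow> (\<Pi>\<^sub>E i\<in>{..<l}. carrier (res_ring q Q i))"
      using bij_betwE[OF bij_betw_inv_into[OF f]]
      by (intro funcsetI restrict_PiE_iff[THEN iffD2]) (auto simp: PiE_iff)
  next
    fix y assume "y \<in> (\<Pi>\<^sub>E i\<in>{..<l}. carrier (res_ring q Q i))"
    then show "?g (\<lambda>i\<in>{..<l}. f i (y i)) = y"
      using bij_betw_inv_into_left[OF f] by (intro ext) (auto simp: PiE_iff extensional_def)
  next
    fix M assume "M \<in> (\<Pi>\<^sub>E i\<in>{..<l}. carrier_mat r r :: 'e mat set)"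
    then show "(\<lambda>i\<in>{..<l}. f i (?g M i)) = M"
      using bij_betw_inv_into_right[OF f] by (intro ext) (auto simp: PiE_iff extensional_def)
  qed
  then show ?thesis by (simp add: R_Gamma_def mat_tuples_def Theta_def[abs_def] f_def)
qed

text \<open>Both differences are computed blockwise on representatives: the difference of two
  classes is the class of \<open>u i - v i\<close>, and its matrix is the difference of the
  matrices.\<close>

lemma dist_ps_eq:
  assumes "y \<in> R_Gamma q l Q" "y' \<in> R_Gamma q l Q"
  shows "dist_ps q l Q y y' = m * dist_SR r l (\<Theta> y) (\<Theta> y')"
proof -
  have ex: "\<forall>i. \<exists>u. i < l \<longrightarrow> z i = PIdl\<^bsub>skew_ring q\<^esub> (Q i) +>\<^bsub>skew_ring q\<^esub> u"
    if "z \<in> R_Gamma q l Q" for z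
    using that by (auto simp: R_Gamma_eq PiE_iff image_iff)
  obtain u where u: "\<And>i. i < l \<Longrightarrow> y i = PIdl\<^bsub>skew_ring q\<^esub> (Q i) +>\<^bsub>skew_ring q\<^esub> u i"
    using ex[OF assms(1)] by metis
  obtain v where v: "\<And>i. i < l \<Longrightarrow> y' i = PIdl\<^bsub>skew_ring q\<^esub> (Q i) +>\<^bsub>skew_ring q\<^esub> v i"
    using ex[OF assms(2)] by metis
  let ?z = "R_Gamma_diff q l Q y y'"
  have z: "?z i = PIdl\<^bsub>skew_ring q\<^esub> (Q i) +>\<^bsub>skew_ring q\<^esub> (u i - v i)" if "i < l" for i
    using that by (simp add: R_Gamma_diff_def res_ring_def u v coset_minus_coset)
  have "?z \<in> R_Gamma q l Q"
    unfolding R_Gamma_eq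
  proof (rule PiE_I)
    fix i assume "i \<notin> {..<l}"
    then show "?z i = undefined" by (simp add: R_Gamma_diff_def)
  qed (simp add: z)
  moreover have "wt_SR r l (\<Theta> ?z) = dist_SR r l (\<Theta> y) (\<Theta> y')"
    unfolding dist_SR_def wt_SR_def
    by (rule sum.cong)
       (auto simp: Theta_def z u v drinfeld_torsion.torsion_matrix_diff[OF torsion])
  ultimately show ?thesis by (simp add: dist_ps_def wt_ps_eq)
qed

end

theorem theorem4p6:
  fixes \<iota> :: "'f::{field,finite} \<Rightarrow> 'k::{field,finite}"
    and q r m l :: nat
    and \<qq> :: "nat \<Rightarrow> 'f poly"
    and \<psi> :: "nat \<Rightarrow> 'f poly set \<Rightarrow> 'e::{field,finite}"
    and b :: "nat \<Rightarrow> nat \<Rightarrow> 'k alg_closure"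
    and Q :: "nat \<Rightarrow> 'k poly"
  assumes card_Fq: "CARD('f) = q"
    and card_Fqr: "CARD('k) = q ^ r"
    and card_Fqm: "CARD('e) = q ^ m"
    and pos: "r \<ge> 1" "m \<ge> 1" "l \<ge> 1"
    and inclusion: "field_hom \<iota>"
    and monic: "\<And>i. i < l \<Longrightarrow> lead_coeff (\<qq> i) = 1"
    and irred: "\<And>i. i < l \<Longrightarrow> irreducible (\<qq> i)"
    and deg: "\<And>i. i < l \<Longrightarrow> Polynomial.degree (\<qq> i) = m"
    and not_T: "\<And>i. i < l \<Longrightarrow> \<qq> i \<noteq> [:0, 1:]"
    and distinct: "inj_on \<qq> {..<l}"
    and residue_iso:
      "\<And>i. i < l \<Longrightarrow> \<psi> i \<in> ring_iso (class_ring Quot (PIdl\<^bsub>class_ring\<^esub> (\<qq> i))) class_ring"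
    and basis_inj: "\<And>i. i < l \<Longrightarrow> inj_on (b i) {..<r}"
    and basis:
      "\<And>i. i < l \<Longrightarrow>
         vectorspace.basis class_ring (torsion_space q \<iota> r (\<qq> i) (\<psi> i)) (b i ` {..<r})"
    and Q: "Q = (\<lambda>i. drinfeld \<iota> r (\<qq> i))"
  shows "Polynomial.degree (skew_Prod q l Q) = m * l * r \<and>
    (\<forall>y\<in>R_Gamma q l Q. wt_ps q l Q y = m * wt_SR r l (Theta q \<iota> r l \<qq> \<psi> b y)) \<and>
    isometry_betw
      (R_Gamma q l Q) (\<lambda>y y'. 1 / real m * real (dist_ps q l Q y y'))
      (mat_tuples r l) (\<lambda>M M'. real (dist_SR r l M M'))
      (Theta q \<iota> r l \<qq> \<psi> b)"
proof -
  interpret frobenius_tower \<iota> q r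
    by (rule frobenius_tower.intro[OF card_Fq card_Fqr inclusion])
  have "drinfeld_torsion \<iota> q r m (\<qq> i) (\<psi> i) (b i)" if "i < l" for i
    by (intro drinfeld_torsion.intro drinfeld_torsion_axioms.intro frobenius_tower_axioms card_Fqm)
       (use monic deg residue_iso basis_inj basis that in blast)+
  then interpret drinfeld_code \<iota> q r m l \<qq> \<psi> b
    by (intro drinfeld_code.intro drinfeld_code_axioms.intro frobenius_tower_axioms distinct)
       (use pos in auto)
  \<comment> \<open>Positivity of \<open>m\<close> lets \<open>1 / real m\<close> cancel the factor
    supplied by \<open>dist_ps_eq\<close>.\<close>
  show ?thesis
    unfolding Q isometry_betw_def using m_pos
    by (auto simp: skew_Prod_D degree_P wt_ps_eq dist_ps_eq bij_betw_Theta)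
qed

end
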